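(* Let $(\omega^+_x)_{x\in\mathbb{Z}}$ and $(\omega^-_x)_{x\in\mathbb{Z}}$ be two independent sequences of i.i.d. random variables, uniform in $\{-1,+1\}$. Let $G$ be the random multigraph with vertex set $\mathbb{Z}$ whose edges are the pairs of the perfect matching of $\mathbb{Z}$ obtained by parenthesis-matching from $\omega^+$ together with the pairs of the perfect matching of $\mathbb{Z}$ obtained by parenthesis-matching from $\omega^-$. Let $n_{\mathrm{paths}}\in\{0,1,2,\ldots\}\cup\{\infty\}$ be the number of infinite connected components of $G$. Then either $n_{\mathrm{paths}}=0$ almost surely, or $n_{\mathrm{paths}}=1$ almost surely.
   Context: Parenthesis-matching: given $\epsilon\in\{-1,+1\}^{\mathbb{Z}}$, interpret $\epsilon_x=+1$ as an opening parenthesis at $x$ and $\epsilon_x=-1$ as a closing parenthesis at $x$. Each opening parenthesis at $x$ is paired with the closing parenthesis at $y=\min\{z>x : \epsilon_x+\epsilon_{x+1}+\cdots+\epsilon_z=0\}$, when this exists. For i.i.d. uniform $\epsilon$, this almost surely yields a (non-crossing) perfect matching of $\mathbb{Z}$, i.e. an involution of $\mathbb{Z}$ without fixed points. Write $E^+$ (resp. $E^-$) for the set of pairs obtained from $\omega^+$ (resp. $\omega^-$). In $G$ every vertex has exactly one edge from $E^+$ and one from $E^-$ (if the same pair belongs to both $E^+$ and $E^-$ it is a double edge), so connected components of $G$ are finite cycles or bi-infinite paths. *)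

theory Defs
  imports "HOL-Probability.Probability" "HOL-Library.Extended_Nat"
begin

definition return_points :: "(int \<Rightarrow> int) \<Rightarrow> int \<Rightarrow> int set" where
  "return_points \<epsilon> x = {z. x < z \<and> (\<Sum>k=x..z. \<epsilon> k) = 0}"

text \<open>
  For a sequence of signs, the partner \<open>y\<close> automatically satisfies \<open>\<epsilon> y = -1\<close>, because
  \<open>y\<close> is the first time at which the partial sums started at \<open>x\<close> return to zero.
\<close>

definition paired :: "(int \<Rightarrow> int) \<Rightarrow> int \<Rightarrow> int \<Rightarrow> bool" where
  "paired \<epsilon> x y \<longleftrightarrow>
     \<epsilon> x = 1 \<and> y \<in> return_points \<epsilon> x \<and> (\<forall>z\<in>return_points \<epsilon> x. y \<le> z)"

definition matching_edges :: "(int \<Rightarrow> int) \<Rightarrow> int set set" where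
  "matching_edges \<epsilon> = {{x, y} | x y. paired \<epsilon> x y}"

text \<open>
  The edges of the multigraph form a disjoint union, so that a pair belonging to both
  matchings gives rise to two parallel edges. Every integer is a vertex.
\<close>

definition graph_edges :: "(int \<Rightarrow> int) \<Rightarrow> (int \<Rightarrow> int) \<Rightarrow> (int set + int set) set" where
  "graph_edges \<epsilon> \<epsilon>' = matching_edges \<epsilon> <+> matching_edges \<epsilon>'"

definition ends :: "int set + int set \<Rightarrow> int set" where
  "ends = case_sum id id"

definition adjacency :: "(int set + int set) set \<Rightarrow> (int \<times> int) set" where
  "adjacency E = {(u, v). \<exists>e\<in>E. ends e = {u, v}}"

definition components :: "(int set + int set) set \<Rightarrow> int set set" where
  "components E = {(adjacency E)\<^sup>* `` {u} | u. u \<in> UNIV}"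

definition ecard :: "'a set \<Rightarrow> enat" where
  "ecard A = (if finite A then enat (card A) else \<infinity>)"

definition n_paths :: "(int \<Rightarrow> int) \<Rightarrow> (int \<Rightarrow> int) \<Rightarrow> enat" where
  "n_paths \<epsilon> \<epsilon>' = ecard {C \<in> components (graph_edges \<epsilon> \<epsilon>'). infinite C}"

end

theory Submission
  imports Defs "HOL-Real_Asymp.Real_Asymp"
begin

text \<open>
  View the two matchings as arcs above and below the real line. Call two gaps of \<open>\<int>\<close> (intervals between
  consecutive integers) adjacent if they lie in the same face of one of the matchings; adjacent gaps have the
  same parity. A component of the multigraph of infinite size is a bi-infinite curve, with an infinite cluster of
  even gaps on one side and an infinite cluster of odd gaps on the other side. Since the number of vertices of a
  component between two gaps of the same cluster is even, two distinct infinite components cannot be flanked by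
  the same pair of clusters. So it suffices that almost surely there is at most one infinite cluster of each parity.

  This follows by the argument of Burton and Keane. Inserting alternating signs into the upper sequence
  at the right end of a window, and into the lower sequence at its left end, preserves null sets, does not change
  the graph outside the window, and connects all even gaps of the window. If three infinite even clusters met a
  window with positive probability, the surgery would produce trifurcations at a positive density, whereas
  their number in an interval of length \<open>n\<close> is at most the number of adjacencies leaving it, which is of the
  order of the range of two simple random walks and hence \<open>o(n)\<close>. If there were exactly two infinite even clusters,
  the surgery would merge them with positive probability, contradicting ergodicity. Ergodicity also gives
  the zero-one law for the existence of an infinite component.
\<close>

section \<open>Parenthesis matching and clusters of gaps\<close>

text \<open>The components themselves have degree two and cannot branch, so the Burton-Keane
  argument is run on clusters of gaps, where three-way branching is possible. Rewriting signs in a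
  window is not a local change: it alters the height gained across the window and can affect
  pairings arbitrarily far away. Inserting a balanced block avoids this, because the walk comes back
  to its old height and the positions further right are merely shifted. The insertion points of the
  two sequences differ, but both insertions shift everything to the right of the window by the same
  amount, so the two matchings still fit together outside; and the blocks sit at opposite ends of
  the window so that together they run through all of its even gaps. Since coins are inserted and
  not overwritten, the original configuration is read off from the new one along an injection of
  indices, which preserves the coin measure.\<close>

definition signs :: "(int \<Rightarrow> int) \<Rightarrow> bool" where
  "signs \<epsilon> \<longleftrightarrow> (\<forall>x. \<epsilon> x = 1 \<or> \<epsilon> x = -1)"

text \<open>The height function of the signs, anchored at \<open>walk \<epsilon> 0 = 0\<close>. The
  subtracted sum is nonempty only for negative \<open>x\<close> and makes the increment at
  \<open>x\<close> equal to \<open>\<epsilon> x\<close> on the whole line.\<close>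

definition walk :: "(int \<Rightarrow> int) \<Rightarrow> int \<Rightarrow> int" where
  "walk \<epsilon> x = (\<Sum>k\<in>{0<..x}. \<epsilon> k) - (\<Sum>k\<in>{x<..0}. \<epsilon> k)"

text \<open>An integer \<open>x\<close> also stands for the gap between the vertices \<open>x\<close> and \<open>x + 1\<close>. The two gaps just
  outside an arc from \<open>x + 1\<close> to \<open>y\<close>, namely \<open>x\<close> and \<open>y\<close>, lie in the same face of the matching.\<close>

definition gap_edge :: "(int \<Rightarrow> int) \<Rightarrow> int \<Rightarrow> int \<Rightarrow> bool" where
  "gap_edge \<epsilon> x y \<longleftrightarrow> paired \<epsilon> (x + 1) y"

definition gap_adj :: "(int \<Rightarrow> int) \<Rightarrow> (int \<Rightarrow> int) \<Rightarrow> (int \<times> int) set" where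
  "gap_adj \<epsilon> \<epsilon>' = {(x, y). gap_edge \<epsilon> x y \<or> gap_edge \<epsilon> y x \<or> gap_edge \<epsilon>' x y \<or> gap_edge \<epsilon>' y x}"

lemma walk_step: "walk \<epsilon> x = walk \<epsilon> (x - 1) + \<epsilon> x"
proof (cases "x \<ge> 1")
  case True
  have "{0<..x} = insert x {0<..x - 1}" using True by auto
  then show ?thesis using True by (simp add: walk_def)
next
  case False
  have "{x - 1<..0} = insert x {x<..0}" using False by auto
  then show ?thesis using False by (simp add: walk_def)
qed

lemma walk_diff: "x \<le> y \<Longrightarrow> walk \<epsilon> y = walk \<epsilon> x + (\<Sum>k\<in>{x<..y}. \<epsilon> k)"
proof (induction y rule: int_ge_induct)
  case base
  then show ?case by simp
next
  case (step i)
  have "{x<..i + 1} = insert (i + 1) {x<..i}" using step by auto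
  then show ?case using step walk_step[of \<epsilon> "i + 1"] by simp
qed

lemma walk_sum: "x < y \<Longrightarrow> (\<Sum>k=x + 1..y. \<epsilon> k) = walk \<epsilon> y - walk \<epsilon> x"
proof -
  assume "x < y"
  moreover have "{x + 1..y} = {x<..y}" by auto
  ultimately show ?thesis using walk_diff[of x y \<epsilon>] by simp
qed

lemma signs_step:
  assumes "signs \<epsilon>"
  shows "walk \<epsilon> (x + 1) = walk \<epsilon> x + 1 \<or> walk \<epsilon> (x + 1) = walk \<epsilon> x - 1"
  using assms walk_step[of \<epsilon> "x + 1"] by (auto simp: signs_def)

lemma signs_up:
  assumes "signs \<epsilon>"
  shows "\<epsilon> (x + 1) = 1 \<longleftrightarrow> walk \<epsilon> x < walk \<epsilon> (x + 1)"
  using assms walk_step[of \<epsilon> "x + 1"] unfolding signs_def by (smt (verit))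

text \<open>Steps of size one cannot jump over a level.\<close>

lemma walk_above:
  assumes "signs \<epsilon>" "walk \<epsilon> x > c" "x \<le> y" "\<And>z. x < z \<Longrightarrow> z \<le> y \<Longrightarrow> walk \<epsilon> z \<noteq> c"
  shows "walk \<epsilon> y > c"
  using assms(3,4)
proof (induction y rule: int_ge_induct)
  case base
  then show ?case using assms(2) by simp
next
  case (step i)
  have "walk \<epsilon> i > c" using step by simp
  moreover have "walk \<epsilon> (i + 1) \<noteq> c" using step by simp
  ultimately show ?case using signs_step[OF assms(1), of i] by linarith
qed

text \<open>Vanishing of the partial sum from \<open>x + 1\<close> to \<open>z\<close> means that
  the height at \<open>z\<close> is again that at \<open>x\<close>. An arc thus becomes an excursion
  strictly above the height of its left outer gap, the form used in all geometric arguments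
  below.\<close>

lemma gap_edge_iff:
  assumes "signs \<epsilon>"
  shows "gap_edge \<epsilon> x y \<longleftrightarrow>
    x < y \<and> walk \<epsilon> y = walk \<epsilon> x \<and> (\<forall>z. x < z \<longrightarrow> z < y \<longrightarrow> walk \<epsilon> x < walk \<epsilon> z)"
    (is "?L \<longleftrightarrow> ?R")
proof
  assume ?L
  then have up: "\<epsilon> (x + 1) = 1" and lt: "x + 1 < y" and s: "(\<Sum>k=x+1..y. \<epsilon> k) = 0"
    and mn: "\<And>z. x + 1 < z \<Longrightarrow> (\<Sum>k=x+1..z. \<epsilon> k) = 0 \<Longrightarrow> y \<le> z"
    by (auto simp: gap_edge_def paired_def return_points_def)
  have hx: "walk \<epsilon> x < walk \<epsilon> (x + 1)" using up signs_up[OF assms] by blast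
  have "walk \<epsilon> x < walk \<epsilon> z" if "x < z" "z < y" for z
  proof (rule walk_above[OF assms hx])
    show "x + 1 \<le> z" using that by simp
    fix w assume w: "x + 1 < w" "w \<le> z"
    then show "walk \<epsilon> w \<noteq> walk \<epsilon> x"
      using mn[of w] that walk_sum[of x w \<epsilon>] by auto
  qed
  then show ?R using lt s walk_sum[of x y \<epsilon>] by auto
next
  assume R: ?R
  then have xy: "x < y" "walk \<epsilon> y = walk \<epsilon> x"
    and mid: "\<And>z. x < z \<Longrightarrow> z < y \<Longrightarrow> walk \<epsilon> x < walk \<epsilon> z" by auto
  have "y \<noteq> x + 1" using signs_step[OF assms, of x] xy by auto
  then have lt: "x + 1 < y" using xy by simp
  have "\<epsilon> (x + 1) = 1" using mid[of "x + 1"] lt signs_up[OF assms] by simp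
  moreover have "y \<le> z" if "x + 1 < z" "(\<Sum>k=x+1..z. \<epsilon> k) = 0" for z
    using mid[of z] that walk_sum[of x z \<epsilon>] by force
  ultimately show ?L using lt xy walk_sum[of x y \<epsilon>]
    by (auto simp: gap_edge_def paired_def return_points_def)
qed

lemma sym_gap_adj: "sym (gap_adj \<epsilon> \<epsilon>')"
  by (auto simp: gap_adj_def sym_def)

lemma gap_adj_commute: "gap_adj \<epsilon> \<epsilon>' = gap_adj \<epsilon>' \<epsilon>"
  by (auto simp: gap_adj_def)

lemma walk_parity:
  assumes "signs \<epsilon>"
  shows "even (walk \<epsilon> x) \<longleftrightarrow> even x"
proof -
  have st: "even (walk \<epsilon> (i + 1)) \<longleftrightarrow> \<not> even (walk \<epsilon> i)" for i
    using signs_step[OF assms, of i] by auto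
  show ?thesis
  proof (induction x rule: int_induct[where k = 0])
    case base
    show ?case by (simp add: walk_def)
  next
    case (step1 i)
    then show ?case using st[of i] by auto
  next
    case (step2 i)
    then show ?case using st[of "i - 1"] by auto
  qed
qed

lemma gap_edge_parity: "signs \<epsilon> \<Longrightarrow> gap_edge \<epsilon> x y \<Longrightarrow> even x = even y"
  using walk_parity by (metis gap_edge_iff)

lemma gap_adj_parity: "signs \<epsilon> \<Longrightarrow> signs \<epsilon>' \<Longrightarrow> (x, y) \<in> gap_adj \<epsilon> \<epsilon>' \<Longrightarrow> even x = even y"
  using gap_edge_parity by (auto simp: gap_adj_def)

lemma first_return:
  assumes "signs \<epsilon>" "x < y" "walk \<epsilon> y = walk \<epsilon> x"
    "\<And>z. x \<le> z \<Longrightarrow> z \<le> y \<Longrightarrow> walk \<epsilon> x \<le> walk \<epsilon> z"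
  obtains r where "gap_edge \<epsilon> x r" "x + 1 < r" "r \<le> y"
proof -
  define A where "A = {z. x < z \<and> z \<le> y \<and> walk \<epsilon> z = walk \<epsilon> x}"
  have fin: "finite A" by (rule finite_subset[of _ "{x..y}"]) (auto simp: A_def)
  have ne: "y \<in> A" using assms by (simp add: A_def)
  define r where "r = Min A"
  have rA: "r \<in> A" unfolding r_def using fin ne by (intro Min_in) auto
  have e: "gap_edge \<epsilon> x r"
    unfolding gap_edge_iff[OF assms(1)]
  proof (intro conjI allI impI)
    show "x < r" "walk \<epsilon> r = walk \<epsilon> x" using rA by (auto simp: A_def)
    fix z assume z: "x < z" "z < r"
    have "z \<notin> A"
    proof
      assume "z \<in> A"
      then have "Min A \<le> z" using fin by simp
      then show False using z by (simp add: r_def)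
    qed
    then show "walk \<epsilon> x < walk \<epsilon> z" using assms(4)[of z] z rA by (force simp: A_def)
  qed
  moreover have "x + 1 < r" using e by (auto simp: gap_edge_def paired_def return_points_def)
  ultimately show ?thesis using that rA by (auto simp: A_def)
qed

text \<open>Just inside an arc the heights again form a stretch that starts and ends at its minimum,
  one level higher. This lets the inside of an arc be treated by the same inductions as the
  outside.\<close>

lemma edge_inner:
  assumes "signs \<epsilon>" "gap_edge \<epsilon> x y"
  shows "walk \<epsilon> (x + 1) = walk \<epsilon> x + 1" "walk \<epsilon> (y - 1) = walk \<epsilon> x + 1"
    "x + 1 \<le> z \<Longrightarrow> z \<le> y - 1 \<Longrightarrow> walk \<epsilon> x + 1 \<le> walk \<epsilon> z"
proof -
  have lt: "x + 1 < y" using assms by (auto simp: gap_edge_def paired_def return_points_def)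
  note E = assms(2)[unfolded gap_edge_iff[OF assms(1)]]
  show "walk \<epsilon> (x + 1) = walk \<epsilon> x + 1"
    using E lt signs_step[OF assms(1), of x] by force
  show "walk \<epsilon> (y - 1) = walk \<epsilon> x + 1"
  proof -
    have "walk \<epsilon> x < walk \<epsilon> (y - 1)" using E lt by simp
    then show ?thesis using E signs_step[OF assms(1), of "y - 1"] by auto
  qed
  show "x + 1 \<le> z \<Longrightarrow> z \<le> y - 1 \<Longrightarrow> walk \<epsilon> x + 1 \<le> walk \<epsilon> z"
    using E by force
qed

text \<open>A stretch with both ends at its minimal height is a concatenation of excursions. Each of
  them is a gap edge, so removing the leftmost one and inducting on the length yields a path of gaps
  at the base height.\<close>

lemma level_connected:
  assumes "signs \<epsilon>" "x \<le> y" "walk \<epsilon> y = walk \<epsilon> x"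
    "\<And>z. x \<le> z \<Longrightarrow> z \<le> y \<Longrightarrow> walk \<epsilon> x \<le> walk \<epsilon> z"
  shows "(x, y) \<in> (gap_adj \<epsilon> \<epsilon>')\<^sup>*"
  using assms(2-)
proof (induction "nat (y - x)" arbitrary: x rule: less_induct)
  case less
  show ?case
  proof (cases "x = y")
    case False
    then obtain r where r: "gap_edge \<epsilon> x r" "x + 1 < r" "r \<le> y"
      using first_return[OF assms(1), of x y] less.prems by force
    have hr: "walk \<epsilon> r = walk \<epsilon> x" using r(1) gap_edge_iff[OF assms(1)] by auto
    have "(r, y) \<in> (gap_adj \<epsilon> \<epsilon>')\<^sup>*"
      by (rule less.hyps) (use r hr less.prems in auto)
    moreover have "(x, r) \<in> gap_adj \<epsilon> \<epsilon>'" using r by (simp add: gap_adj_def)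
    ultimately show ?thesis by (rule converse_rtrancl_into_rtrancl[rotated])
  qed simp
qed

text \<open>The leftmost excursion, from \<open>x\<close> to \<open>r\<close>, has the paired
  vertices \<open>x + 1\<close> and \<open>r\<close>, which lie both in \<open>C\<close> or both
  outside. Its inside and the stretch after it are shorter, hence contribute even numbers by
  induction.\<close>

lemma even_card_level:
  assumes "signs \<epsilon>" "x \<le> y" "walk \<epsilon> y = walk \<epsilon> x"
    "\<And>z. x \<le> z \<Longrightarrow> z \<le> y \<Longrightarrow> walk \<epsilon> x \<le> walk \<epsilon> z"
    and C: "\<And>u v. paired \<epsilon> u v \<Longrightarrow> u \<in> C \<longleftrightarrow> v \<in> C"
  shows "even (card (C \<inter> {x<..y}))"
  using assms(2-4)
proof (induction "nat (y - x)" arbitrary: x y rule: less_induct)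
  case less
  show ?case
  proof (cases "x = y")
    case False
    then obtain r where r: "gap_edge \<epsilon> x r" "x + 1 < r" "r \<le> y"
      using first_return[OF assms(1), of x y] less.prems by force
    have hr: "walk \<epsilon> r = walk \<epsilon> x" using r(1) gap_edge_iff[OF assms(1)] by auto
    note inner = edge_inner[OF assms(1) r(1)]
    have e1: "even (card (C \<inter> {r<..y}))"
      by (rule less.hyps) (use r hr less.prems in auto)
    have e2: "even (card (C \<inter> {x + 1<..r - 1}))"
      by (rule less.hyps) (use r inner in auto)
    have C': "x + 1 \<in> C \<longleftrightarrow> r \<in> C" using C r(1) by (simp add: gap_edge_def)
    have e3: "even (card (C \<inter> {x + 1, r}))" using C' r
      by (cases "r \<in> C") auto
    have eq: "C \<inter> {x<..y} = (C \<inter> {x + 1, r}) \<union> ((C \<inter> {x + 1<..r - 1}) \<union> (C \<inter> {r<..y}))"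
      using r by auto
    have "card (C \<inter> {x<..y}) = card (C \<inter> {x + 1, r}) + (card (C \<inter> {x + 1<..r - 1}) + card (C \<inter> {r<..y}))"
      unfolding eq using r by (subst card_Un_disjoint; (subst card_Un_disjoint)?; auto)
    then show ?thesis using e1 e2 e3 by simp
  qed simp
qed

text \<open>A discrete Jordan curve theorem: the parity of the number of vertices of a component
  between a fixed gap and a given gap tells on which side of the component the gap lies.\<close>

definition side :: "int set \<Rightarrow> int \<Rightarrow> bool" where
  "side C x \<longleftrightarrow> even (card (C \<inter> {0<..x}) + card (C \<inter> {x<..0}))"

lemma side_diff: "x \<le> y \<Longrightarrow> side C y = side C x \<longleftrightarrow> even (card (C \<inter> {x<..y}))"
proof (induction y rule: int_ge_induct)
  case base
  then show ?case by simp
next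
  case (step i)
  have 1: "side C (i + 1) = (side C i \<noteq> (i + 1 \<in> C))"
  proof (cases "i \<ge> 0")
    case True
    have "{0<..i + 1} = insert (i + 1) {0<..i}" using True by auto
    then show ?thesis using True by (auto simp: side_def Int_insert_right)
  next
    case False
    have "{i<..0} = insert (i + 1) {i + 1<..0}" using False by auto
    then show ?thesis using False by (auto simp: side_def Int_insert_right)
  qed
  have "{x<..i + 1} = insert (i + 1) {x<..i}" using step by auto
  then have "even (card (C \<inter> {x<..i + 1})) = (even (card (C \<inter> {x<..i})) \<noteq> (i + 1 \<in> C))"
    by (auto simp: Int_insert_right)
  then show ?case using step 1 by auto
qed

lemma side_step: "side C p = side C (p - 1) \<longleftrightarrow> p \<notin> C"
proof -
  have "{p - 1<..p} = {p}" by auto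
  then show ?thesis using side_diff[of "p - 1" p C] by (auto simp: Int_insert_right)
qed

definition match_adj :: "(int \<Rightarrow> int) \<Rightarrow> (int \<Rightarrow> int) \<Rightarrow> (int \<times> int) set" where
  "match_adj \<epsilon> \<epsilon>' = {(x, y). paired \<epsilon> x y \<or> paired \<epsilon> y x \<or> paired \<epsilon>' x y \<or> paired \<epsilon>' y x}"

lemma sym_match_adj: "sym (match_adj \<epsilon> \<epsilon>')"
  by (auto simp: match_adj_def sym_def)

lemma adjacency_graph_edges: "adjacency (graph_edges \<epsilon> \<epsilon>') = match_adj \<epsilon> \<epsilon>'"
proof -
  have lt: "paired \<epsilon> x y \<Longrightarrow> x < y" for \<epsilon> x y
    by (simp add: paired_def return_points_def)
  have "(u, v) \<in> adjacency (graph_edges \<epsilon> \<epsilon>') \<longleftrightarrow> (u, v) \<in> match_adj \<epsilon> \<epsilon>'" for u v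
  proof -
    have "(u, v) \<in> adjacency (graph_edges \<epsilon> \<epsilon>') \<longleftrightarrow>
        {u, v} \<in> matching_edges \<epsilon> \<or> {u, v} \<in> matching_edges \<epsilon>'"
      by (simp add: adjacency_def graph_edges_def ends_def Plus_def bex_Un)
    moreover have "{u, v} \<in> matching_edges \<epsilon> \<longleftrightarrow> paired \<epsilon> u v \<or> paired \<epsilon> v u" for \<epsilon>
      unfolding matching_edges_def doubleton_eq_iff mem_Collect_eq by blast
    ultimately show ?thesis by (auto simp: match_adj_def)
  qed
  then show ?thesis by auto
qed

text \<open>Between the ends of a gap edge the walk never drops below the base height, so
  \<open>even_card_level\<close> applies to the matching that contributes the edge. A set closed
  under both matchings therefore has the same side along a whole cluster.\<close>

lemma side_gap_adj:
  assumes "signs \<epsilon>" "signs \<epsilon>'" "(x, y) \<in> (gap_adj \<epsilon> \<epsilon>')\<^sup>*"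
    and C: "\<And>u v. (u, v) \<in> match_adj \<epsilon> \<epsilon>' \<Longrightarrow> u \<in> C \<longleftrightarrow> v \<in> C"
  shows "side C x = side C y"
proof -
  have edge: "side C u = side C v" if "gap_edge e u v" "signs e"
    and C: "\<And>u v. paired e u v \<Longrightarrow> u \<in> C \<longleftrightarrow> v \<in> C" for e u v
  proof -
    note E = that(1)[unfolded gap_edge_iff[OF that(2)]]
    have "even (card (C \<inter> {u<..v}))"
    proof (rule even_card_level[OF that(2)])
      fix z assume "u \<le> z" "z \<le> v"
      then show "walk e u \<le> walk e z" using E by (smt (verit))
    qed (use E C in auto)
    then show ?thesis using side_diff[of u v C] E by auto
  qed
  have st: "side C u = side C v" if "(u, v) \<in> gap_adj \<epsilon> \<epsilon>'" for u v
    using that edge[of \<epsilon> u v] edge[of \<epsilon> v u] edge[of \<epsilon>' u v] edge[of \<epsilon>' v u] assms(1,2) C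
    unfolding gap_adj_def match_adj_def by blast
  show ?thesis using assms(3) by induction (use st in auto)
qed

text \<open>The vertex \<open>p\<close> separates the gaps \<open>p - 1\<close> and
  \<open>p\<close>, exactly one of which is even; these functions name the neighbouring gap of
  either parity.\<close>

definition even_gap :: "int \<Rightarrow> int" where "even_gap p = (if even p then p else p - 1)"
definition odd_gap :: "int \<Rightarrow> int" where "odd_gap p = (if even p then p - 1 else p)"

text \<open>The outer gaps \<open>u - 1\<close> and \<open>v\<close> are joined by the arc itself,
  the inner gaps \<open>u\<close> and \<open>v - 1\<close> along the stretch beneath it. As
  \<open>u\<close> and \<open>v\<close> have opposite parity, one of these pairs consists of the
  even gaps and the other of the odd ones.\<close>

lemma paired_gaps:
  assumes "signs \<epsilon>" "paired \<epsilon> u v"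
  shows "(even_gap u, even_gap v) \<in> (gap_adj \<epsilon> \<epsilon>')\<^sup>*" "(odd_gap u, odd_gap v) \<in> (gap_adj \<epsilon> \<epsilon>')\<^sup>*"
proof -
  have e: "gap_edge \<epsilon> (u - 1) v" using assms by (simp add: gap_edge_def)
  have par: "even u \<longleftrightarrow> odd v" using gap_edge_parity[OF assms(1) e] by auto
  have lt: "u < v" using assms by (simp add: paired_def return_points_def)
  have outer: "(u - 1, v) \<in> (gap_adj \<epsilon> \<epsilon>')\<^sup>*" using e by (auto simp: gap_adj_def)
  have inner: "(u, v - 1) \<in> (gap_adj \<epsilon> \<epsilon>')\<^sup>*"
    by (rule level_connected[OF assms(1)]) (use edge_inner[OF assms(1) e] lt in auto)
  show "(even_gap u, even_gap v) \<in> (gap_adj \<epsilon> \<epsilon>')\<^sup>*" "(odd_gap u, odd_gap v) \<in> (gap_adj \<epsilon> \<epsilon>')\<^sup>*"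
    using par inner outer by (auto simp: even_gap_def odd_gap_def)
qed

lemma match_path_gaps:
  assumes "signs \<epsilon>" "signs \<epsilon>'" "(u, v) \<in> (match_adj \<epsilon> \<epsilon>')\<^sup>*"
  shows "(even_gap u, even_gap v) \<in> (gap_adj \<epsilon> \<epsilon>')\<^sup>* \<and> (odd_gap u, odd_gap v) \<in> (gap_adj \<epsilon> \<epsilon>')\<^sup>*"
  using assms(3)
proof induction
  case (step v w)
  have s: "(a, b) \<in> (gap_adj \<epsilon> \<epsilon>')\<^sup>* \<Longrightarrow> (b, a) \<in> (gap_adj \<epsilon> \<epsilon>')\<^sup>*" for a b
    using sym_rtrancl[OF sym_gap_adj] by (meson symD)
  have "(even_gap v, even_gap w) \<in> (gap_adj \<epsilon> \<epsilon>')\<^sup>* \<and> (odd_gap v, odd_gap w) \<in> (gap_adj \<epsilon> \<epsilon>')\<^sup>*"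
    using step(2) paired_gaps[OF assms(1), of _ _ \<epsilon>'] paired_gaps[OF assms(2), of _ _ \<epsilon>] s
      gap_adj_commute[of \<epsilon>' \<epsilon>] unfolding match_adj_def by auto
  then show ?case using step(3) by (meson rtrancl_trans)
qed auto

definition gap_cluster :: "(int \<Rightarrow> int) \<Rightarrow> (int \<Rightarrow> int) \<Rightarrow> int \<Rightarrow> int set" where
  "gap_cluster \<epsilon> \<epsilon>' x = (gap_adj \<epsilon> \<epsilon>')\<^sup>* `` {x}"

text \<open>Only the parity of \<open>r\<close> matters; it ranges over all integers so that a
  translation acts on it by addition. The property also holds when there is no infinite cluster of
  that parity.\<close>

definition unique_cluster :: "(int \<Rightarrow> int) \<Rightarrow> (int \<Rightarrow> int) \<Rightarrow> int \<Rightarrow> bool" where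
  "unique_cluster \<epsilon> \<epsilon>' r \<longleftrightarrow> (\<forall>x y. even (x - r) \<longrightarrow> even (y - r) \<longrightarrow>
     infinite (gap_cluster \<epsilon> \<epsilon>' x) \<longrightarrow> infinite (gap_cluster \<epsilon> \<epsilon>' y) \<longrightarrow> (x, y) \<in> (gap_adj \<epsilon> \<epsilon>')\<^sup>*)"

lemma infinite_gaps:
  assumes "signs \<epsilon>" "signs \<epsilon>'" "infinite ((match_adj \<epsilon> \<epsilon>')\<^sup>* `` {p})"
  shows "infinite (gap_cluster \<epsilon> \<epsilon>' (even_gap p))" "infinite (gap_cluster \<epsilon> \<epsilon>' (odd_gap p))"
proof -
  let ?C = "(match_adj \<epsilon> \<epsilon>')\<^sup>* `` {p}"
  \<comment> \<open>Such an \<open>f\<close> is at most two-to-one, since \<open>x\<close> is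
    \<open>f x\<close> or \<open>f x + 1\<close>; so it maps an infinite component to an infinite
    set of gaps.\<close>
  have *: "infinite (f ` ?C)" if "\<And>x. f x = x \<or> f x = x - 1" for f
  proof
    assume "finite (f ` ?C)"
    then have "finite (f ` ?C \<union> (\<lambda>x. x + 1) ` f ` ?C)" by simp
    moreover have "?C \<subseteq> f ` ?C \<union> (\<lambda>x. x + 1) ` f ` ?C"
    proof
      fix x assume x: "x \<in> ?C"
      then have "f x \<in> f ` ?C" by blast
      then show "x \<in> f ` ?C \<union> (\<lambda>x. x + 1) ` f ` ?C" using that[of x] by force
    qed
    ultimately show False using assms(3) finite_subset by blast
  qed
  have "even_gap ` ?C \<subseteq> gap_cluster \<epsilon> \<epsilon>' (even_gap p)" "odd_gap ` ?C \<subseteq> gap_cluster \<epsilon> \<epsilon>' (odd_gap p)"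
    using match_path_gaps[OF assms(1,2)] by (auto simp: gap_cluster_def)
  moreover have "infinite (even_gap ` ?C)" "infinite (odd_gap ` ?C)"
    by (rule *; simp add: even_gap_def odd_gap_def)+
  ultimately show "infinite (gap_cluster \<epsilon> \<epsilon>' (even_gap p))" "infinite (gap_cluster \<epsilon> \<epsilon>' (odd_gap p))"
    using finite_subset by blast+
qed

text \<open>Crossing \<open>p\<close> changes the side of its component \<open>C\<close>, whereas
  crossing a vertex \<open>q\<close> outside \<open>C\<close> does not. But uniqueness puts the even
  gaps at \<open>p\<close> and \<open>q\<close> in one cluster, and likewise the odd gaps, so their
  sides agree.\<close>

lemma at_most_one_path:
  assumes "signs \<epsilon>" "signs \<epsilon>'" "unique_cluster \<epsilon> \<epsilon>' 0" "unique_cluster \<epsilon> \<epsilon>' 1"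
    and "infinite ((match_adj \<epsilon> \<epsilon>')\<^sup>* `` {p})" "infinite ((match_adj \<epsilon> \<epsilon>')\<^sup>* `` {q})"
  shows "(p, q) \<in> (match_adj \<epsilon> \<epsilon>')\<^sup>*"
proof (rule ccontr)
  assume nq: "(p, q) \<notin> (match_adj \<epsilon> \<epsilon>')\<^sup>*"
  define C where "C = (match_adj \<epsilon> \<epsilon>')\<^sup>* `` {p}"
  have C: "u \<in> C \<longleftrightarrow> v \<in> C" if "(u, v) \<in> match_adj \<epsilon> \<epsilon>'" for u v
    using that symD[OF sym_match_adj that] unfolding C_def by (auto intro: rtrancl_into_rtrancl)
  have "(even_gap p, even_gap q) \<in> (gap_adj \<epsilon> \<epsilon>')\<^sup>*" "(odd_gap p, odd_gap q) \<in> (gap_adj \<epsilon> \<epsilon>')\<^sup>*"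
    using assms(3,4) infinite_gaps[OF assms(1,2,5)] infinite_gaps[OF assms(1,2,6)]
    unfolding unique_cluster_def by (auto simp: even_gap_def odd_gap_def)
  then have "side C (even_gap p) = side C (even_gap q)" "side C (odd_gap p) = side C (odd_gap q)"
    using side_gap_adj[OF assms(1,2) _ C] by blast+
  moreover have "p \<in> C" "q \<notin> C" using nq by (auto simp: C_def)
  ultimately show False using side_step[of C p] side_step[of C q]
    by (auto simp: even_gap_def odd_gap_def split: if_splits)
qed

lemma n_paths_eq_0:
  assumes "\<And>p. finite ((match_adj \<epsilon> \<epsilon>')\<^sup>* `` {p})"
  shows "n_paths \<epsilon> \<epsilon>' = 0"
proof -
  have "{C \<in> components (graph_edges \<epsilon> \<epsilon>'). infinite C} = {}"
    unfolding components_def adjacency_graph_edges using assms by blast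
  then show ?thesis unfolding n_paths_def by (simp only: ecard_def finite.emptyI card.empty zero_enat_def if_True)
qed

lemma n_paths_eq_1:
  assumes "signs \<epsilon>" "signs \<epsilon>'" "unique_cluster \<epsilon> \<epsilon>' 0" "unique_cluster \<epsilon> \<epsilon>' 1"
    and inf: "infinite ((match_adj \<epsilon> \<epsilon>')\<^sup>* `` {p})"
  shows "n_paths \<epsilon> \<epsilon>' = 1"
proof -
  have eqv: "equiv UNIV ((match_adj \<epsilon> \<epsilon>')\<^sup>*)"
    by (intro equivI refl_rtrancl sym_rtrancl trans_rtrancl sym_match_adj) auto
  have "(match_adj \<epsilon> \<epsilon>')\<^sup>* `` {q} = (match_adj \<epsilon> \<epsilon>')\<^sup>* `` {p}"
    if "infinite ((match_adj \<epsilon> \<epsilon>')\<^sup>* `` {q})" for q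
    using equiv_class_eq[OF eqv at_most_one_path[OF assms(1-5) that]] by simp
  then have "{C \<in> components (graph_edges \<epsilon> \<epsilon>'). infinite C} = {(match_adj \<epsilon> \<epsilon>')\<^sup>* `` {p}}"
    unfolding components_def adjacency_graph_edges using inf by blast
  then show ?thesis by (simp add: n_paths_def ecard_def one_enat_def)
qed


section \<open>Counting trifurcations\<close>

text \<open>Combinatorial core of the Burton-Keane bound. Delete the \<open>t\<close> with the
  smallest \<open>A t \<union> B t\<close> together with a point \<open>a\<close> of
  \<open>A t\<close>. No other union fits inside \<open>A t\<close>, a proper subset of the smallest
  one, so every other \<open>A s\<close> and \<open>B s\<close> keeps a point different from
  \<open>a\<close>, and induction applies.\<close>

lemma laminar_card_le:
  assumes "finite T" "finite Y"
    and "\<And>t. t \<in> T \<Longrightarrow> A t \<subseteq> Y \<and> B t \<subseteq> Y \<and> A t \<noteq> {} \<and> B t \<noteq> {} \<and> A t \<inter> B t = {}"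
    and "\<And>s t. s \<in> T \<Longrightarrow> t \<in> T \<Longrightarrow> s \<noteq> t \<Longrightarrow>
      A s \<union> B s \<subseteq> A t \<or> A s \<union> B s \<subseteq> B t \<or> A t \<union> B t \<subseteq> A s \<or> A t \<union> B t \<subseteq> B s \<or>
      (A s \<union> B s) \<inter> (A t \<union> B t) = {}"
  shows "card T \<le> card Y"
  using assms
proof (induction "card T" arbitrary: T Y A B)
  case 0
  then show ?case by simp
next
  case (Suc k)
  note sets = Suc.prems(3) and lam = Suc.prems(4)
  have "T \<noteq> {}" using Suc.hyps(2) by auto
  then obtain t where t: "t \<in> T" "\<And>s. s \<in> T \<Longrightarrow> card (A t \<union> B t) \<le> card (A s \<union> B s)"
    using ex_min_if_finite[of "(\<lambda>s. card (A s \<union> B s)) ` T"] Suc.prems(1)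
    by (fastforce simp: not_less)
  obtain a where a: "a \<in> A t" using sets[OF t(1)] by blast
  have fin: "finite (A s \<union> B s)" if "s \<in> T" for s
    using sets[OF that] Suc.prems(2) by (auto intro: finite_subset)
  have less: "\<not> A s \<union> B s \<subseteq> A t" if "s \<in> T" for s
  proof
    assume "A s \<union> B s \<subseteq> A t"
    moreover have "A t \<subset> A t \<union> B t" using sets[OF t(1)] by blast
    ultimately have "card (A s \<union> B s) < card (A t \<union> B t)"
      using fin[OF t(1)] by (meson order_le_less_trans psubset_card_mono)
    then show False using t(2)[OF that] by simp
  qed
  have ne: "A s - {a} \<noteq> {} \<and> B s - {a} \<noteq> {}" if "s \<in> T - {t}" for s
  proof -
    have s: "s \<in> T" "s \<noteq> t" using that by auto
    show ?thesis using lam[OF s(1) t(1) s(2)] less[OF s(1)] sets[OF s(1)] sets[OF t(1)] a by auto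
  qed
  have "card (T - {t}) \<le> card (Y - {a})"
  proof (rule Suc.hyps(1)[where A = "\<lambda>s. A s - {a}" and B = "\<lambda>s. B s - {a}"])
    show "k = card (T - {t})" using Suc.hyps(2) t(1) Suc.prems(1) by simp
    fix s assume s: "s \<in> T - {t}"
    show "A s - {a} \<subseteq> Y - {a} \<and> B s - {a} \<subseteq> Y - {a} \<and> A s - {a} \<noteq> {} \<and> B s - {a} \<noteq> {} \<and>
        (A s - {a}) \<inter> (B s - {a}) = {}"
      using sets[of s] ne[OF s] s by auto
  next
    fix s r assume "s \<in> T - {t}" "r \<in> T - {t}" "s \<noteq> r"
    then show "A s - {a} \<union> (B s - {a}) \<subseteq> A r - {a} \<or> A s - {a} \<union> (B s - {a}) \<subseteq> B r - {a} \<or>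
      A r - {a} \<union> (B r - {a}) \<subseteq> A s - {a} \<or> A r - {a} \<union> (B r - {a}) \<subseteq> B s - {a} \<or>
      (A s - {a} \<union> (B s - {a})) \<inter> (A r - {a} \<union> (B r - {a})) = {}"
      using lam[of s r] by blast
  qed (use Suc.prems in auto)
  moreover have "a \<in> Y" using a sets[OF t(1)] by blast
  then have "card (Y - {a}) = card Y - 1" "card Y \<noteq> 0" using Suc.prems(2) by auto
  moreover have "card (T - {t}) = card T - 1" using t(1) Suc.prems(1) by simp
  ultimately show ?case by linarith
qed

definition avoiding :: "('v \<times> 'v) set \<Rightarrow> 'v set \<Rightarrow> ('v \<times> 'v) set" where
  "avoiding R t = R \<inter> (- t) \<times> (- t)"

definition branch :: "('v \<times> 'v) set \<Rightarrow> 'v set \<Rightarrow> 'v \<Rightarrow> bool" where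
  "branch R t a \<longleftrightarrow> a \<notin> t \<and> (\<exists>x\<in>t. (x, a) \<in> R) \<and> infinite ((avoiding R t)\<^sup>* `` {a})"

definition hub :: "('v \<times> 'v) set \<Rightarrow> 'v set \<Rightarrow> bool" where
  "hub R t \<longleftrightarrow> (\<forall>x\<in>t. \<forall>y\<in>t. (x, y) \<in> (R \<inter> t \<times> t)\<^sup>*)"

text \<open>A trifurcation in the sense of Burton and Keane, with a set \<open>t\<close> that is
  connected within itself in the role of the branching vertex. Branches are represented by
  neighbours of \<open>t\<close>; the last three conditions say that they lie in different
  components once \<open>t\<close> is deleted.\<close>

definition trifurcation :: "('v \<times> 'v) set \<Rightarrow> 'v set \<Rightarrow> bool" where
  "trifurcation R t \<longleftrightarrow> hub R t \<and> (\<exists>a b c. branch R t a \<and> branch R t b \<and> branch R t c \<and>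
     (a, b) \<notin> (avoiding R t)\<^sup>* \<and> (a, c) \<notin> (avoiding R t)\<^sup>* \<and> (b, c) \<notin> (avoiding R t)\<^sup>*)"

lemma sym_avoiding: "sym R \<Longrightarrow> sym (avoiding R t)"
  by (auto simp: avoiding_def sym_def)

lemma avoiding_sym_path: "sym R \<Longrightarrow> (x, y) \<in> (avoiding R t)\<^sup>* \<Longrightarrow> (y, x) \<in> (avoiding R t)\<^sup>*"
  using sym_rtrancl[OF sym_avoiding] by (meson symD)

lemma avoiding_subset: "(avoiding R t)\<^sup>* \<subseteq> R\<^sup>*"
  by (rule rtrancl_mono) (auto simp: avoiding_def)

lemma first_exit:
  assumes "(x, y) \<in> S\<^sup>*" "x \<in> L" "y \<notin> L"
  obtains p q where "(x, p) \<in> S\<^sup>*" "(p, q) \<in> S" "p \<in> L" "q \<notin> L"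
proof -
  have "y \<notin> L \<longrightarrow> (\<exists>p q. (x, p) \<in> S\<^sup>* \<and> (p, q) \<in> S \<and> p \<in> L \<and> q \<notin> L)"
    using assms(1) by induction (use assms(2) in blast)+
  then show ?thesis using that assms(3) by blast
qed

lemma first_hit:
  assumes "(x, y) \<in> R\<^sup>*" "x \<notin> W" "y \<in> W"
  obtains p w where "(x, p) \<in> (avoiding R W)\<^sup>*" "(p, w) \<in> R" "p \<notin> W" "w \<in> W"
proof -
  have "(y \<notin> W \<and> (x, y) \<in> (avoiding R W)\<^sup>*) \<or>
      (\<exists>p w. (x, p) \<in> (avoiding R W)\<^sup>* \<and> (p, w) \<in> R \<and> p \<notin> W \<and> w \<in> W)"
    using assms(1)
  proof induction
    case base
    then show ?case using assms(2) by simp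
  next
    case (step y z)
    show ?case
    proof (cases "z \<in> W")
      case True
      then show ?thesis using step by blast
    next
      case False
      then have "(y, z) \<in> avoiding R W" if "y \<notin> W" using step(2) that by (auto simp: avoiding_def)
      then show ?thesis using step(3) False by (meson rtrancl.rtrancl_into_rtrancl)
    qed
  qed
  then show ?thesis using that assms(3) by blast
qed

text \<open>In each trifurcation two branches avoid a root chosen once for every cluster among the exits
  of \<open>L\<close>. Traced on the exits, these pairs of branches form a laminar family.\<close>

lemma trifurcations_le_exits:
  fixes R :: "('v \<times> 'v) set"
  assumes R: "sym R" and L: "finite L" and Y: "Y = {u. u \<notin> L \<and> (\<exists>y\<in>L. (y, u) \<in> R)}" "finite Y"
    and T: "finite T" "\<And>t. t \<in> T \<Longrightarrow> trifurcation R t \<and> t \<subseteq> L \<and> t \<noteq> {}"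
    and disj: "\<And>s t. s \<in> T \<Longrightarrow> t \<in> T \<Longrightarrow> s \<noteq> t \<Longrightarrow> s \<inter> t = {}"
  shows "card T \<le> card Y"
proof -
  define Br where "Br t a = (avoiding R t)\<^sup>* `` {a}" for t a
  define K where "K t = R\<^sup>* `` t" for t
  \<comment> \<open>The choice depends on \<open>t\<close> only through its cluster
    \<open>K t\<close>, so all windows in one cluster get the same root.\<close>
  define root where "root t = (SOME y. y \<in> Y \<inter> K t)" for t
  have BrK: "Br t a \<subseteq> K t" if br: "branch R t a" for t a
  proof
    fix y assume "y \<in> Br t a"
    then have "(a, y) \<in> R\<^sup>*" using avoiding_subset[of R t] by (auto simp: Br_def)
    moreover obtain x where "x \<in> t" "(x, a) \<in> R" using br unfolding branch_def by blast
    ultimately show "y \<in> K t" unfolding K_def by (meson ImageI converse_rtrancl_into_rtrancl)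
  qed
  \<comment> \<open>A branch is infinite and \<open>L\<close> is finite, so the branch leaves
    \<open>L\<close>, and it does so through a point of \<open>Y\<close>.\<close>
  have exit: "Br t a \<inter> Y \<noteq> {}" if "t \<in> T" "branch R t a" for t a
  proof (cases "a \<in> L")
    case False
    then have "a \<in> Y" using that T(2) unfolding Y(1) branch_def by blast
    then show ?thesis by (force simp: Br_def)
  next
    case True
    have "\<not> Br t a \<subseteq> L" using that L finite_subset unfolding branch_def Br_def by blast
    then obtain v where v: "(a, v) \<in> (avoiding R t)\<^sup>*" "v \<notin> L" by (auto simp: Br_def)
    obtain p q where pq: "(a, p) \<in> (avoiding R t)\<^sup>*" "(p, q) \<in> avoiding R t" "p \<in> L" "q \<notin> L"
      by (rule first_exit[OF v(1) True v(2)])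
    then have "q \<in> Y" unfolding Y(1) avoiding_def by blast
    moreover have "q \<in> Br t a" using rtrancl.rtrancl_into_rtrancl[OF pq(1,2)] by (simp add: Br_def)
    ultimately show ?thesis by blast
  qed
  have Br_disj: "Br t a \<inter> Br t b = {}" if "(a, b) \<notin> (avoiding R t)\<^sup>*" for t a b
  proof (rule ccontr)
    assume "Br t a \<inter> Br t b \<noteq> {}"
    then obtain y where "(a, y) \<in> (avoiding R t)\<^sup>*" "(b, y) \<in> (avoiding R t)\<^sup>*" by (auto simp: Br_def)
    then show False using that avoiding_sym_path[OF R] by (meson rtrancl_trans)
  qed
  have Br_eq: "Br t a = Br t b" if "(a, b) \<in> (avoiding R t)\<^sup>*" for t a b
  proof (rule set_eqI)
    show "x \<in> Br t a \<longleftrightarrow> x \<in> Br t b" for x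
      using that avoiding_sym_path[OF R that] unfolding Br_def Image_singleton_iff
      by (meson rtrancl_trans)
  qed
  have root: "root t \<in> Y \<inter> K t" if t: "t \<in> T" for t
  proof -
    obtain a where a: "branch R t a" using T(2)[OF t] unfolding trifurcation_def by blast
    then have "\<exists>y. y \<in> Y \<inter> K t" using exit[OF t a] BrK[OF a] by blast
    then show ?thesis unfolding root_def by (rule someI_ex)
  qed
  \<comment> \<open>The three branches are disjoint, so the root lies in at most one of them and at
    least two avoid it.\<close>
  have "\<forall>t\<in>T. \<exists>a b. branch R t a \<and> branch R t b \<and> (a, b) \<notin> (avoiding R t)\<^sup>* \<and>
      root t \<notin> Br t a \<and> root t \<notin> Br t b"
  proof
    fix t assume "t \<in> T"
    then obtain a b c where abc: "branch R t a" "branch R t b" "branch R t c"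
      "(a, b) \<notin> (avoiding R t)\<^sup>*" "(a, c) \<notin> (avoiding R t)\<^sup>*" "(b, c) \<notin> (avoiding R t)\<^sup>*"
      using T(2) unfolding trifurcation_def by blast
    show "\<exists>a b. branch R t a \<and> branch R t b \<and> (a, b) \<notin> (avoiding R t)\<^sup>* \<and>
      root t \<notin> Br t a \<and> root t \<notin> Br t b"
      using abc Br_disj[OF abc(4)] Br_disj[OF abc(5)] Br_disj[OF abc(6)]
      by (cases "root t \<in> Br t a"; cases "root t \<in> Br t b") blast+
  qed
  then obtain a b where br: "\<And>t. t \<in> T \<Longrightarrow> branch R t (a t)" "\<And>t. t \<in> T \<Longrightarrow> branch R t (b t)"
    and ab: "\<And>t. t \<in> T \<Longrightarrow> (a t, b t) \<notin> (avoiding R t)\<^sup>*"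
    and ra: "\<And>t. t \<in> T \<Longrightarrow> root t \<notin> Br t (a t)" and rb: "\<And>t. t \<in> T \<Longrightarrow> root t \<notin> Br t (b t)"
    by metis
  define A where "A t = Br t (a t)" for t
  define B where "B t = Br t (b t)" for t
  have hub_avoid: "(x, y) \<in> (avoiding R t)\<^sup>*" if "s \<in> T" "x \<in> s" "y \<in> s" "s \<inter> t = {}" for s t x y
  proof -
    have "(x, y) \<in> (R \<inter> s \<times> s)\<^sup>*" using that T(2)[OF that(1)] unfolding trifurcation_def hub_def by blast
    moreover have "R \<inter> s \<times> s \<subseteq> avoiding R t" using that(4) by (auto simp: avoiding_def)
    ultimately show ?thesis using rtrancl_mono by blast
  qed
  \<comment> \<open>If \<open>t\<close> is joined to the root off \<open>s\<close>, it lies in a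
    component of the complement of \<open>s\<close> other than the two chosen branches. These
    branches therefore miss \<open>t\<close>, and being linked through \<open>s\<close> they lie in
    a single component off \<open>t\<close>, which is \<open>A t\<close>, or \<open>B t\<close>, or
    disjoint from both.\<close>
  have nested: "A s \<union> B s \<subseteq> A t \<or> A s \<union> B s \<subseteq> B t \<or> (A s \<union> B s) \<inter> (A t \<union> B t) = {}"
    if st: "s \<in> T" "t \<in> T" "s \<inter> t = {}" and r: "\<And>x. x \<in> t \<Longrightarrow> (x, root s) \<in> (avoiding R s)\<^sup>*" for s t
  proof -
    have sub: "Br s c \<subseteq> Br t c" if c: "branch R s c" "root s \<notin> Br s c" for c
    proof
      have avoid: "Br s c \<inter> t = {}"
      proof (rule ccontr)
        assume "Br s c \<inter> t \<noteq> {}"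
        then obtain x where "x \<in> t" "(c, x) \<in> (avoiding R s)\<^sup>*" by (auto simp: Br_def)
        then have "(c, root s) \<in> (avoiding R s)\<^sup>*" using r rtrancl_trans by metis
        then show False using c(2) by (simp add: Br_def)
      qed
      fix y assume "y \<in> Br s c"
      then have "(c, y) \<in> (avoiding R s)\<^sup>*" by (simp add: Br_def)
      then show "y \<in> Br t c"
      proof induction
        case base
        then show ?case by (simp add: Br_def)
      next
        case (step y z)
        have "y \<in> Br s c" "z \<in> Br s c"
          using step(1) rtrancl.rtrancl_into_rtrancl[OF step(1,2)] by (simp_all add: Br_def)
        then have "y \<notin> t" "z \<notin> t" using avoid by blast+
        then have "(y, z) \<in> avoiding R t" using step(2) by (auto simp: avoiding_def)
        then show ?case using step(3) rtrancl.rtrancl_into_rtrancl by (force simp: Br_def)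
      qed
    qed
    have out: "c \<notin> t" if "branch R s c" "root s \<notin> Br s c" for c
      using that r unfolding Br_def by blast
    obtain x y where xy: "x \<in> s" "(x, a s) \<in> R" "y \<in> s" "(y, b s) \<in> R"
      using br st unfolding branch_def by meson
    have "(x, a s) \<in> avoiding R t" "(y, b s) \<in> avoiding R t"
      using xy st out[OF br(1) ra] out[OF br(2) rb] by (auto simp: avoiding_def)
    then have "(a s, b s) \<in> (avoiding R t)\<^sup>*"
      using hub_avoid[OF st(1) xy(1,3) st(3)] avoiding_sym_path[OF R]
      by (meson converse_rtrancl_into_rtrancl r_into_rtrancl rtrancl_trans)
    then have 1: "A s \<union> B s \<subseteq> Br t (a s)"
      using sub br ra rb st Br_eq unfolding A_def B_def by blast
    have 2: "Br t (a s) = Br t c \<or> Br t (a s) \<inter> Br t c = {}" for c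
      using Br_eq Br_disj by blast
    show ?thesis using 1 2[of "a t"] 2[of "b t"] unfolding A_def B_def by blast
  qed
  \<comment> \<open>A path from the root towards \<open>s\<close> enters \<open>s \<union> t\<close>
    at some first point. The window entered there is joined to the root off the other window, by the
    path and by its own connectedness.\<close>
  have reach: "(\<forall>x\<in>t. (x, root s) \<in> (avoiding R s)\<^sup>*) \<or> (\<forall>x\<in>s. (x, root s) \<in> (avoiding R t)\<^sup>*)"
    if st: "s \<in> T" "t \<in> T" "s \<inter> t = {}" for s t
  proof -
    have rs: "root s \<in> Y" "root s \<in> K s" using root st by auto
    have "root s \<notin> s \<union> t" using rs(1) T(2) st unfolding Y(1) by blast
    moreover obtain x where "x \<in> s" "(root s, x) \<in> R\<^sup>*"
      using rs(2) sym_rtrancl[OF R] unfolding K_def Image_iff by (metis symD)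
    ultimately obtain p w where pw: "(root s, p) \<in> (avoiding R (s \<union> t))\<^sup>*" "(p, w) \<in> R" "p \<notin> s \<union> t"
        "w \<in> s \<union> t"
      using first_hit[of "root s" x R "s \<union> t"] by blast
    have hit: "\<forall>x\<in>u. (x, root s) \<in> (avoiding R v)\<^sup>*"
      if "w \<in> u" "u \<in> T" "u \<inter> v = {}" "v \<subseteq> s \<union> t" for u v
    proof
      fix x assume "x \<in> u"
      have "avoiding R (s \<union> t) \<subseteq> avoiding R v" using that by (auto simp: avoiding_def)
      then have "(root s, p) \<in> (avoiding R v)\<^sup>*" using pw(1) rtrancl_mono by blast
      moreover have "(p, w) \<in> avoiding R v" using pw that by (auto simp: avoiding_def)
      ultimately have "(root s, w) \<in> (avoiding R v)\<^sup>*" by simp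
      then show "(x, root s) \<in> (avoiding R v)\<^sup>*"
        using hub_avoid[OF that(2) \<open>x \<in> u\<close> that(1) that(3)] avoiding_sym_path[OF R]
        by (meson rtrancl_trans)
    qed
    show ?thesis using pw(4) hit[of t s] hit[of s t] st by blast
  qed
  \<comment> \<open>For windows in one cluster, hence with a common root, \<open>reach\<close>
    decides in which direction \<open>nested\<close> applies; windows in different clusters have
    disjoint branches.\<close>
  have lam: "A s \<union> B s \<subseteq> A t \<or> A s \<union> B s \<subseteq> B t \<or> A t \<union> B t \<subseteq> A s \<or> A t \<union> B t \<subseteq> B s \<or>
      (A s \<union> B s) \<inter> (A t \<union> B t) = {}" if st: "s \<in> T" "t \<in> T" "s \<noteq> t" for s t
  proof (cases "K s = K t")
    case True
    then have "root s = root t" by (simp add: root_def)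
    then show ?thesis
      using reach[OF st(1,2) disj[OF st]] nested[OF st(1,2) disj[OF st]]
        nested[OF st(2,1)] disj[OF st] by (metis Int_commute)
  next
    case False
    have conn: "(x, y) \<in> R\<^sup>*" if "x \<in> u" "y \<in> u" "u \<in> T" for x y u
      using hub_avoid[OF that(3,1,2), of "{}"] avoiding_subset by blast
    have "K s \<inter> K t = {}"
    proof (rule ccontr)
      assume "K s \<inter> K t \<noteq> {}"
      then obtain x y z where "x \<in> s" "y \<in> t" "(x, z) \<in> R\<^sup>*" "(y, z) \<in> R\<^sup>*"
        unfolding K_def by blast
      then have xy: "x \<in> s" "y \<in> t" "(x, y) \<in> R\<^sup>*" "(y, x) \<in> R\<^sup>*"
        using sym_rtrancl[OF R] by (meson symD rtrancl_trans)+
      have "K s = K t"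
      proof
        show "K s \<subseteq> K t"
          using conn[OF _ xy(1) st(1)] conn[OF xy(1) _ st(1)] xy unfolding K_def
          by (smt (verit) ImageE ImageI rtrancl_trans subsetI)
        show "K t \<subseteq> K s"
          using conn[OF _ xy(2) st(2)] conn[OF xy(2) _ st(2)] xy unfolding K_def
          by (smt (verit) ImageE ImageI rtrancl_trans subsetI)
      qed
      then show False using False by simp
    qed
    then show ?thesis using BrK br st unfolding A_def B_def by blast
  qed
  show ?thesis
  proof (rule laminar_card_le[OF T(1) Y(2), where A = "\<lambda>t. A t \<inter> Y" and B = "\<lambda>t. B t \<inter> Y"])
    fix t assume t: "t \<in> T"
    show "A t \<inter> Y \<subseteq> Y \<and> B t \<inter> Y \<subseteq> Y \<and> A t \<inter> Y \<noteq> {} \<and> B t \<inter> Y \<noteq> {} \<and> (A t \<inter> Y) \<inter> (B t \<inter> Y) = {}"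
      using exit[OF t br(1)[OF t]] exit[OF t br(2)[OF t]] Br_disj[OF ab[OF t]]
      unfolding A_def B_def by blast
  next
    fix s t assume "s \<in> T" "t \<in> T" "s \<noteq> t"
    from lam[OF this]
    show "A s \<inter> Y \<union> B s \<inter> Y \<subseteq> A t \<inter> Y \<or> A s \<inter> Y \<union> B s \<inter> Y \<subseteq> B t \<inter> Y \<or>
      A t \<inter> Y \<union> B t \<inter> Y \<subseteq> A s \<inter> Y \<or> A t \<inter> Y \<union> B t \<inter> Y \<subseteq> B s \<inter> Y \<or>
      (A s \<inter> Y \<union> B s \<inter> Y) \<inter> (A t \<inter> Y \<union> B t \<inter> Y) = {}"
      by blast
  qed
qed

text \<open>Exits on one side that belong to the same walk have different heights, since the arc of
  the farther one passes over the nearer one. Each of these heights is attained in the interval,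
  which leaves \<open>2 * h + 1\<close> values for each of two sides and two walks.\<close>

lemma gap_exits:
  assumes "signs \<epsilon>" "signs \<epsilon>'"
    and h: "\<And>x. 0 \<le> x \<Longrightarrow> x \<le> n \<Longrightarrow> \<bar>walk \<epsilon> x\<bar> \<le> h" "\<And>x. 0 \<le> x \<Longrightarrow> x \<le> n \<Longrightarrow> \<bar>walk \<epsilon>' x\<bar> \<le> h"
    and Y: "Y = {u. u \<notin> {0..n} \<and> (\<exists>y\<in>{0..n}. (y, u) \<in> gap_adj \<epsilon> \<epsilon>')}"
  shows "finite Y \<and> card Y \<le> 4 * nat (2 * h + 1)"
proof -
  define YL where "YL \<epsilon> = {u. u < 0 \<and> (\<exists>y\<in>{0..n}. gap_edge \<epsilon> u y)}" for \<epsilon>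
  define YR where "YR \<epsilon> = {u. n < u \<and> (\<exists>y\<in>{0..n}. gap_edge \<epsilon> y u)}" for \<epsilon>
  have sides: "finite (YL e) \<and> card (YL e) \<le> nat (2 * h + 1) \<and> finite (YR e) \<and> card (YR e) \<le> nat (2 * h + 1)"
    if e: "signs e" "\<And>x. 0 \<le> x \<Longrightarrow> x \<le> n \<Longrightarrow> \<bar>walk e x\<bar> \<le> h" for e
  proof -
    have "inj_on (walk e) (YL e)"
    proof (rule linorder_inj_onI)
      fix u v assume "u < v" "u \<in> YL e" "v \<in> YL e"
      then show "walk e u \<noteq> walk e v" using gap_edge_iff[OF e(1)] by (force simp: YL_def)
    qed auto
    moreover have "inj_on (walk e) (YR e)"
    proof (rule linorder_inj_onI)
      fix u v assume "u < v" "u \<in> YR e" "v \<in> YR e"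
      then show "walk e u \<noteq> walk e v" using gap_edge_iff[OF e(1)] by (force simp: YR_def)
    qed auto
    moreover have "walk e ` YL e \<subseteq> {-h..h}" "walk e ` YR e \<subseteq> {-h..h}"
      using e(2) gap_edge_iff[OF e(1)] unfolding YL_def YR_def by (force simp: abs_le_iff)+
    ultimately have "finite (YL e)" "card (YL e) \<le> card {-h..h}"
        "finite (YR e)" "card (YR e) \<le> card {-h..h}"
      by (meson card_inj_on_le finite_atLeastAtMost_int inj_on_finite)+
    then show ?thesis by simp
  qed
  have "Y \<subseteq> (YL \<epsilon> \<union> YR \<epsilon>) \<union> (YL \<epsilon>' \<union> YR \<epsilon>')"
  proof
    fix u assume "u \<in> Y"
    then obtain y where y: "u \<notin> {0..n}" "y \<in> {0..n}" "(y, u) \<in> gap_adj \<epsilon> \<epsilon>'" unfolding Y by blast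
    have lt: "gap_edge e v w \<Longrightarrow> v < w" for e v w
      by (simp add: gap_edge_def paired_def return_points_def)
    show "u \<in> (YL \<epsilon> \<union> YR \<epsilon>) \<union> (YL \<epsilon>' \<union> YR \<epsilon>')"
      using y lt[of \<epsilon> u y] lt[of \<epsilon> y u] lt[of \<epsilon>' u y] lt[of \<epsilon>' y u]
      by (cases "u < 0") (auto simp: gap_adj_def YL_def YR_def)
  qed
  moreover have "card ((YL \<epsilon> \<union> YR \<epsilon>) \<union> (YL \<epsilon>' \<union> YR \<epsilon>')) \<le> 4 * nat (2 * h + 1)"
    using sides[OF assms(1) h(1)] sides[OF assms(2) h(2)]
      card_Un_le[of "YL \<epsilon>" "YR \<epsilon>"] card_Un_le[of "YL \<epsilon>'" "YR \<epsilon>'"]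
      card_Un_le[of "YL \<epsilon> \<union> YR \<epsilon>" "YL \<epsilon>' \<union> YR \<epsilon>'"] by linarith
  moreover have "finite ((YL \<epsilon> \<union> YR \<epsilon>) \<union> (YL \<epsilon>' \<union> YR \<epsilon>'))"
    using sides[OF assms(1) h(1)] sides[OF assms(2) h(2)] by simp
  ultimately show ?thesis by (meson card_mono finite_subset le_trans)
qed

section \<open>Surgery on a window\<close>

lemma gap_edge_unique:
  assumes "signs \<epsilon>"
  shows "gap_edge \<epsilon> x y \<Longrightarrow> gap_edge \<epsilon> x y' \<Longrightarrow> y = y'"
    and "gap_edge \<epsilon> x y \<Longrightarrow> gap_edge \<epsilon> x' y \<Longrightarrow> x = x'"
  unfolding gap_edge_iff[OF assms] by (metis less_irrefl linorder_neqE)+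

text \<open>Each matching gives a gap at most one edge to the right and one to the left.\<close>

lemma gap_adj_finite_degree:
  assumes "signs \<epsilon>" "signs \<epsilon>'"
  shows "finite (gap_adj \<epsilon> \<epsilon>' `` {x})"
proof -
  have fin: "finite A" if "\<And>a b. a \<in> A \<Longrightarrow> b \<in> A \<Longrightarrow> a = b" for A :: "int set"
  proof (cases "A = {}")
    case False
    then obtain a where "a \<in> A" by blast
    then have "A = {a}" using that by blast
    then show ?thesis by simp
  qed simp
  have "finite {y. gap_edge e x y}" "finite {y. gap_edge e y x}" if "signs e" for e
    using gap_edge_unique[OF that] by (auto intro!: fin)
  moreover have "gap_adj \<epsilon> \<epsilon>' `` {x} =
      ({y. gap_edge \<epsilon> x y} \<union> {y. gap_edge \<epsilon> y x}) \<union> ({y. gap_edge \<epsilon>' x y} \<union> {y. gap_edge \<epsilon>' y x})"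
    by (auto simp: gap_adj_def)
  ultimately show ?thesis using assms by simp
qed

text \<open>By local finiteness the cluster is covered by \<open>t\<close> and the components, off
  \<open>t\<close>, of finitely many neighbours of \<open>t\<close>; one of these components must be
  infinite.\<close>

lemma infinite_cluster_branch:
  assumes R: "sym R" "\<And>x. finite (R `` {x})" and t: "finite t" "x \<in> t" and inf: "infinite (R\<^sup>* `` {x})"
  obtains a where "branch R t a" "(x, a) \<in> R\<^sup>*"
proof -
  define N where "N = (\<Union>y\<in>t. R `` {y}) \<inter> R\<^sup>* `` {x} - t"
  have "finite N" using R t by (auto simp: N_def)
  have "R\<^sup>* `` {x} \<subseteq> t \<union> (\<Union>a\<in>N. (avoiding R t)\<^sup>* `` {a})"
  proof
    fix y assume "y \<in> R\<^sup>* `` {x}"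
    then have xy: "(x, y) \<in> R\<^sup>*" by simp
    then have yx: "(y, x) \<in> R\<^sup>*" using sym_rtrancl[OF R(1)] by (meson symD)
    show "y \<in> t \<union> (\<Union>a\<in>N. (avoiding R t)\<^sup>* `` {a})"
    proof (cases "y \<in> t")
      case False
      then obtain p w where pw: "(y, p) \<in> (avoiding R t)\<^sup>*" "(p, w) \<in> R" "p \<notin> t" "w \<in> t"
        using first_hit[OF yx _ t(2)] by blast
      have "(x, p) \<in> R\<^sup>*" using xy pw(1) avoiding_subset by (meson rtrancl_trans subsetD)
      then have "p \<in> N" using pw R(1) by (auto simp: N_def dest: symD)
      moreover have "(p, y) \<in> (avoiding R t)\<^sup>*" using avoiding_sym_path[OF R(1) pw(1)] .
      ultimately show ?thesis by blast
    qed simp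
  qed
  then have "infinite (t \<union> (\<Union>a\<in>N. (avoiding R t)\<^sup>* `` {a}))" using inf finite_subset by blast
  then obtain a where "a \<in> N" "infinite ((avoiding R t)\<^sup>* `` {a})"
    using t(1) \<open>finite N\<close> by auto
  then show ?thesis using that unfolding branch_def N_def by blast
qed

text \<open>In the surgery below, \<open>\<nu>\<close> is the sequence of signs after the insertion of an alternating
  block, and \<open>excise\<close> recovers the sequence before it.\<close>

definition block :: "int \<Rightarrow> int \<Rightarrow> (int \<Rightarrow> int) \<Rightarrow> bool" where
  "block z m \<nu> \<longleftrightarrow> (\<forall>x. z < x \<longrightarrow> x \<le> z + m \<longrightarrow> \<nu> x = (if odd x then 1 else -1))"

definition excise :: "int \<Rightarrow> int \<Rightarrow> (int \<Rightarrow> int) \<Rightarrow> int \<Rightarrow> int" where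
  "excise z m \<nu> x = (if x \<le> z then \<nu> x else \<nu> (x + m))"

lemma signs_excise: "signs \<nu> \<Longrightarrow> signs (excise z m \<nu>)"
  by (auto simp: signs_def excise_def)

text \<open>As \<open>z\<close> is even, the block starts with an up-step, so the walk alternates
  between the height at \<open>z\<close> and the height one above it.\<close>

lemma walk_block:
  assumes "block z m \<nu>" "even z" "z \<le> x" "x \<le> z + m"
  shows "walk \<nu> x = walk \<nu> z + (if odd x then 1 else 0)"
  using assms(3,4)
proof (induction x rule: int_ge_induct)
  case base
  then show ?case using assms(2) by simp
next
  case (step i)
  have "\<nu> (i + 1) = (if odd (i + 1) then 1 else -1)" using assms(1) step by (simp add: block_def)
  then show ?case using step walk_step[of \<nu> "i + 1"] by auto
qed

text \<open>Heights are anchored at 0, so for \<open>0 \<le> z\<close> only signs at positions up to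
  \<open>z\<close> enter on either side.\<close>

lemma walk_excise_le: "0 \<le> z \<Longrightarrow> x \<le> z \<Longrightarrow> walk (excise z m \<nu>) x = walk \<nu> x"
  unfolding walk_def by (intro arg_cong2[where f = "(-)"] sum.cong) (auto simp: excise_def)

lemma walk_excise_ge:
  assumes "block z m \<nu>" "even z" "even m" "0 \<le> z" "0 \<le> m" "z \<le> x"
  shows "walk (excise z m \<nu>) x = walk \<nu> (x + m)"
  using assms(6)
proof (induction x rule: int_ge_induct)
  case base
  then show ?case using walk_block[OF assms(1,2), of "z + m"] walk_excise_le[of z z m \<nu>] assms by simp
next
  case (step i)
  moreover have "excise z m \<nu> (i + 1) = \<nu> (i + 1 + m)" using step by (simp add: excise_def)
  moreover have "i + 1 + m - 1 = i + m" by simp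
  ultimately show ?case
    using walk_step[of \<nu> "i + 1 + m"] walk_step[of "excise z m \<nu>" "i + 1"] by simp
qed

text \<open>For \<open>0 \<le> m\<close> this is the increasing map from old positions to new ones,
  with the block omitted from its image. The position \<open>z\<close> stays at the left end of the
  block.\<close>

definition shift_after :: "int \<Rightarrow> int \<Rightarrow> int \<Rightarrow> int" where
  "shift_after z m x = (if x \<le> z then x else x + m)"

context
  fixes \<nu> :: "int \<Rightarrow> int" and z m :: int
  assumes nu: "signs \<nu>" "block z m \<nu>" and z: "even z" "0 \<le> z" and m: "even m" "0 \<le> m"
begin

lemma walk_shift_after: "walk \<nu> (shift_after z m x) = walk (excise z m \<nu>) x"
  using walk_excise_le[OF z(2), of x m \<nu>] walk_excise_ge[OF nu(2) z(1) m(1) z(2) m(2), of x]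
  by (auto simp: shift_after_def)

lemma shift_after_less: "shift_after z m x < shift_after z m y \<longleftrightarrow> x < y"
  using m by (auto simp: shift_after_def)

text \<open>The block stays at or above the height at \<open>z\<close>, so an arc passing over
  \<open>z\<close> also passes over the block. An arc that leaves \<open>z\<close> to the right has
  to start at \<open>z + m\<close>, where the walk is back at the height of \<open>z\<close>; an arc
  that ends at \<open>z\<close> still ends there.\<close>

lemma gap_edge_excise:
  assumes "gap_edge (excise z m \<nu>) x y"
  shows "x \<noteq> z \<Longrightarrow> gap_edge \<nu> (shift_after z m x) (shift_after z m y)"
    and "x = z \<Longrightarrow> gap_edge \<nu> (z + m) (shift_after z m y)"
proof -
  note E = assms[unfolded gap_edge_iff[OF signs_excise[OF nu(1)]]]
  have between: "walk \<nu> (shift_after z m x) < walk \<nu> w"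
    if "shift_after z m x < w" "w < shift_after z m y" "x \<noteq> z \<or> z + m < w" for w
  proof (cases "z < w \<and> w \<le> z + m")
    case True
    then have "x < z" "z < y" using that by (auto simp: shift_after_def split: if_splits)
    then have "walk (excise z m \<nu>) x < walk (excise z m \<nu>) z" using E by simp
    moreover have "walk (excise z m \<nu>) z = walk \<nu> z" using walk_excise_le[OF z(2)] by simp
    moreover have "walk \<nu> z \<le> walk \<nu> w" using walk_block[OF nu(2) z(1), of w] True by simp
    ultimately show ?thesis by (simp add: walk_shift_after)
  next
    case False
    define w' where "w' = (if w \<le> z then w else w - m)"
    have w: "w = shift_after z m w'" using False by (auto simp: w'_def shift_after_def)
    then have "x < w'" "w' < y" using that shift_after_less by auto
    then have "walk (excise z m \<nu>) x < walk (excise z m \<nu>) w'" using E by simp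
    then show ?thesis by (simp add: walk_shift_after w)
  qed
  show "gap_edge \<nu> (shift_after z m x) (shift_after z m y)" if "x \<noteq> z"
    unfolding gap_edge_iff[OF nu(1)]
    using between E that by (auto simp: walk_shift_after shift_after_less)
  show "gap_edge \<nu> (z + m) (shift_after z m y)" if "x = z"
    unfolding gap_edge_iff[OF nu(1)]
  proof (intro conjI allI impI)
    show "z + m < shift_after z m y" using E that by (auto simp: shift_after_def)
    have eq: "walk \<nu> (z + m) = walk \<nu> (shift_after z m x)"
      using walk_block[OF nu(2) z(1), of "z + m"] m z that by (simp add: shift_after_def)
    show "walk \<nu> (shift_after z m y) = walk \<nu> (z + m)" unfolding eq walk_shift_after using E by simp
    fix w assume "z + m < w" "w < shift_after z m y"
    then show "walk \<nu> (z + m) < walk \<nu> w" unfolding eq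
      using between[of w] m that by (auto simp: shift_after_def)
  qed
qed

lemma gap_edge_unexcise:
  assumes "gap_edge \<nu> (shift_after z m x) (shift_after z m y)"
  shows "gap_edge (excise z m \<nu>) x y"
  unfolding gap_edge_iff[OF signs_excise[OF nu(1)]]
proof (intro conjI allI impI)
  note E = assms[unfolded gap_edge_iff[OF nu(1)]]
  show "x < y" using E shift_after_less by auto
  show "walk (excise z m \<nu>) y = walk (excise z m \<nu>) x" using E by (simp add: walk_shift_after)
  fix w assume "x < w" "w < y"
  then have "walk \<nu> (shift_after z m x) < walk \<nu> (shift_after z m w)"
    using E shift_after_less by auto
  then show "walk (excise z m \<nu>) x < walk (excise z m \<nu>) w" by (simp add: walk_shift_after)
qed

lemma gap_edge_block:
  assumes "even x" "z \<le> x" "x < z + m"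
  shows "gap_edge \<nu> x (x + 2)"
  unfolding gap_edge_iff[OF nu(1)]
proof (intro conjI allI impI)
  have x2: "x + 2 \<le> z + m" using assms z m by presburger
  show "walk \<nu> (x + 2) = walk \<nu> x"
    using walk_block[OF nu(2) z(1), of x] walk_block[OF nu(2) z(1), of "x + 2"] assms x2 by simp
  fix w assume "x < w" "w < x + 2"
  then have "w = x + 1" by simp
  then show "walk \<nu> x < walk \<nu> w"
    using walk_block[OF nu(2) z(1), of x] walk_block[OF nu(2) z(1), of "x + 1"] assms x2 by simp
qed simp

end

text \<open>The surgery replaces a window of length \<open>m\<close> by one of length \<open>2 * m\<close>: the new upper walk makes
  \<open>m\<close> alternating steps after the old ones, the new lower walk makes them before the old ones. This leaves
  the outside of the window unchanged and connects all even gaps of the new window, the first half by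
  means of the lower walk and the second half by means of the upper walk.\<close>

locale surgery =
  fixes \<nu>\<^sub>1 \<nu>\<^sub>2 :: "int \<Rightarrow> int" and m :: int
  assumes signs1: "signs \<nu>\<^sub>1" and signs2: "signs \<nu>\<^sub>2"
    and block1: "block m m \<nu>\<^sub>1" and block2: "block 0 m \<nu>\<^sub>2"
    and m: "even m" "0 \<le> m"
begin

abbreviation "\<sigma>\<^sub>1 \<equiv> excise m m \<nu>\<^sub>1"
abbreviation "\<sigma>\<^sub>2 \<equiv> excise 0 m \<nu>\<^sub>2"

definition "R = gap_adj \<sigma>\<^sub>1 \<sigma>\<^sub>2"
definition "R' = gap_adj \<nu>\<^sub>1 \<nu>\<^sub>2"
definition "t = {x. even x \<and> 0 \<le> x \<and> x \<le> m}"
definition "t' = {x. even x \<and> 0 \<le> x \<and> x \<le> 2 * m}"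
definition "\<theta> x = (if x < 0 then x else x + m)" for x :: int

lemma sym_R: "sym R" and sym_R': "sym R'"
  by (simp_all add: R_def R'_def sym_gap_adj)

lemma R_parity: "(x, y) \<in> R \<Longrightarrow> even x = even y" and R'_parity: "(x, y) \<in> R' \<Longrightarrow> even x = even y"
  unfolding R_def R'_def
  using gap_adj_parity[OF signs_excise signs_excise, OF signs1 signs2] gap_adj_parity[OF signs1 signs2] by blast+

lemma finite_t: "finite t" and finite_t': "finite t'"
  by (rule finite_subset[of _ "{0..m}"], auto simp: t_def)
    (rule finite_subset[of _ "{0..2 * m}"], auto simp: t'_def)

lemma inj_theta: "\<theta> x = \<theta> y \<Longrightarrow> x = y"
  using m by (auto simp: \<theta>_def split: if_splits)

lemma even_theta: "even (\<theta> x) = even x"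
  using m by (auto simp: \<theta>_def)

lemma theta_t': "x \<notin> t \<Longrightarrow> \<theta> x \<notin> t'"
  using m even_theta[of x] by (auto simp: \<theta>_def t_def t'_def)

lemma theta_surj:
  assumes "even y" "y \<notin> t'"
  obtains x where "y = \<theta> x" "even x" "x \<notin> t"
proof (rule that[of "if y < 0 then y else y - m"])
qed (use assms m in \<open>auto simp: \<theta>_def t_def t'_def\<close>)

text \<open>On even gaps off the window the insertions at \<open>m\<close> and at \<open>0\<close>
  have the same effect, so a single map \<open>\<theta>\<close> serves both matchings.\<close>

lemma theta_shift:
  assumes "even x" "x \<notin> t"
  shows "shift_after m m x = \<theta> x" "shift_after 0 m x = \<theta> x" "x \<noteq> 0" "x \<noteq> m"
  using assms m by (auto simp: \<theta>_def t_def shift_after_def)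

lemma gap_edge_theta:
  assumes "even u" "u \<notin> t" "even v" "v \<notin> t"
  shows "gap_edge \<sigma>\<^sub>1 u v \<longleftrightarrow> gap_edge \<nu>\<^sub>1 (\<theta> u) (\<theta> v)"
    and "gap_edge \<sigma>\<^sub>2 u v \<longleftrightarrow> gap_edge \<nu>\<^sub>2 (\<theta> u) (\<theta> v)"
  using gap_edge_excise(1)[OF signs1 block1 m m, of u v] gap_edge_unexcise[OF signs1 block1 m m, of u v]
    gap_edge_excise(1)[OF signs2 block2 _ _ m, of u v] gap_edge_unexcise[OF signs2 block2 _ _ m, of u v]
    theta_shift[OF assms(1,2)] theta_shift[OF assms(3,4)] by auto

lemma R_theta:
  assumes "even u" "u \<notin> t" "even v" "v \<notin> t"
  shows "(u, v) \<in> R \<longleftrightarrow> (\<theta> u, \<theta> v) \<in> R'"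
  using gap_edge_theta[OF assms] gap_edge_theta[OF assms(3,4,1,2)]
  by (simp add: R_def R'_def gap_adj_def)

text \<open>Stated for both insertion points, \<open>m\<close> for the upper and \<open>0\<close>
  for the lower sequence. The end in the old window goes to its shifted copy, or to
  \<open>z + m\<close> when the arc starts at the insertion point; both lie in the new
  window.\<close>

lemma window_edge:
  assumes "gap_edge (excise z m \<nu>) u v" "u \<in> t \<and> v \<notin> t \<or> u \<notin> t \<and> v \<in> t"
    "signs \<nu>" "block z m \<nu>" "z = 0 \<or> z = m"
  shows "\<exists>w\<in>t'. gap_edge \<nu> w (\<theta> v) \<and> u \<in> t \<or> gap_edge \<nu> (\<theta> u) w \<and> v \<in> t"
proof -
  have z: "even z" "0 \<le> z" "z \<le> m" using assms(5) m by auto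
  note excise = gap_edge_excise[OF assms(3,4) z(1,2) m assms(1)]
  have par: "even u = even v" using gap_edge_parity[OF signs_excise[OF assms(3)] assms(1)] .
  have sh: "shift_after z m x = \<theta> x" if "even x" "x \<notin> t" for x
    using theta_shift[OF that] assms(5) by auto
  have win: "shift_after z m x \<in> t'" if "x \<in> t" for x
    using that z m by (auto simp: shift_after_def t_def t'_def)
  have zm: "z + m \<in> t'" using z m by (auto simp: t'_def)
  show ?thesis
  proof (cases "u \<in> t")
    case True
    then have "v \<notin> t" "even v" using assms(2) par by (auto simp: t_def)
    then show ?thesis using excise sh[of v] win[of u] zm True by (cases "u = z") auto
  next
    case False
    then have v: "v \<in> t" "even u" using assms(2) par by (auto simp: t_def)
    then have "u \<noteq> z" using theta_shift[of u] False assms(5) by auto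
    then show ?thesis using excise(1) sh[of u] win[of v] v False by auto
  qed
qed

lemma window_adj:
  assumes "(x, a) \<in> R" "x \<in> t" "a \<notin> t"
  obtains w where "w \<in> t'" "(w, \<theta> a) \<in> R'"
proof -
  have "gap_edge \<sigma>\<^sub>1 x a \<or> gap_edge \<sigma>\<^sub>1 a x \<or> gap_edge \<sigma>\<^sub>2 x a \<or> gap_edge \<sigma>\<^sub>2 a x"
    using assms(1) by (simp add: R_def gap_adj_def)
  then have "\<exists>w\<in>t'. gap_edge \<nu>\<^sub>1 w (\<theta> a) \<or> gap_edge \<nu>\<^sub>1 (\<theta> a) w \<or>
      gap_edge \<nu>\<^sub>2 w (\<theta> a) \<or> gap_edge \<nu>\<^sub>2 (\<theta> a) w"
    using window_edge[OF _ _ signs1 block1, of x a] window_edge[OF _ _ signs1 block1, of a x]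
      window_edge[OF _ _ signs2 block2, of x a] window_edge[OF _ _ signs2 block2, of a x] assms(2,3)
    by blast
  then show ?thesis using that by (auto simp: R'_def gap_adj_def)
qed

lemma avoiding_theta:
  assumes "(a, b) \<in> (avoiding R t)\<^sup>*" "even a" "a \<notin> t"
  shows "(\<theta> a, \<theta> b) \<in> (avoiding R' t')\<^sup>* \<and> even b \<and> b \<notin> t"
  using assms(1)
proof induction
  case base
  then show ?case using assms by simp
next
  case (step b c)
  then have bc: "(b, c) \<in> R" "b \<notin> t" "c \<notin> t" "even b" by (auto simp: avoiding_def)
  then have "even c" using R_parity by auto
  then have "(\<theta> b, \<theta> c) \<in> avoiding R' t'"
    using bc R_theta[of b c] theta_t' by (auto simp: avoiding_def)
  then show ?case using step bc \<open>even c\<close> by auto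
qed

text \<open>Even gaps off the two windows correspond under \<open>\<theta>\<close>, so paths can be
  pulled back. Parity has to be carried along: odd gaps between 0 and \<open>2 * m\<close> are not
  in \<open>t'\<close> but need not be values of \<open>\<theta>\<close>.\<close>

lemma avoiding_theta_rev:
  assumes "(\<theta> a, y) \<in> (avoiding R' t')\<^sup>*" "even a" "a \<notin> t"
  shows "\<exists>b. y = \<theta> b \<and> (a, b) \<in> (avoiding R t)\<^sup>* \<and> even b \<and> b \<notin> t"
  using assms(1)
proof induction
  case base
  then show ?case using assms by auto
next
  case (step y z)
  then obtain b where b: "y = \<theta> b" "(a, b) \<in> (avoiding R t)\<^sup>*" "even b" "b \<notin> t" by auto
  have yz: "(y, z) \<in> R'" "z \<notin> t'" using step(2) by (auto simp: avoiding_def)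
  then have "even z" using R'_parity[of y z] b even_theta by auto
  then obtain c where c: "z = \<theta> c" "even c" "c \<notin> t" using theta_surj yz(2) by metis
  then have "(b, c) \<in> avoiding R t" using R_theta[of b c] b yz by (auto simp: avoiding_def)
  then have "(a, c) \<in> (avoiding R t)\<^sup>*" using b(2) by simp
  then show ?case using c by blast
qed

lemma hub_window: "hub R' t'"
proof -
  let ?S = "R' \<inter> t' \<times> t'"
  have edge: "(x, x + 2) \<in> ?S" if "even x" "0 \<le> x" "x < 2 * m" for x
  proof -
    have "x + 2 \<le> 2 * m" using that m by presburger
    moreover have "(x, x + 2) \<in> R'"
      using gap_edge_block[OF signs1 block1 m m, of x] gap_edge_block[OF signs2 block2 _ _ m, of x] that
      by (cases "x < m") (auto simp: R'_def gap_adj_def)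
    ultimately show ?thesis using that by (auto simp: t'_def)
  qed
  have sym: "sym (?S\<^sup>*)" using sym_R' by (intro sym_rtrancl) (auto simp: sym_def)
  have from_zero: "(0, 2 * int k) \<in> ?S\<^sup>*" if "2 * int k \<le> 2 * m" for k
    using that
  proof (induction k)
    case (Suc k)
    have "(2 * int k, 2 * int k + 2) \<in> ?S" by (rule edge) (use Suc.prems in auto)
    moreover have "(0, 2 * int k) \<in> ?S\<^sup>*" by (rule Suc.IH) (use Suc.prems in simp)
    moreover have "2 * int (Suc k) = 2 * int k + 2" by simp
    ultimately show ?case by (metis rtrancl.rtrancl_into_rtrancl)
  qed simp
  have "(0, x) \<in> ?S\<^sup>*" if "x \<in> t'" for x
    using from_zero[of "nat (x div 2)"] that by (auto simp: t'_def elim!: evenE)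
  then show ?thesis unfolding hub_def using sym by (meson rtrancl_trans symD)
qed

lemma branch_theta:
  assumes "branch R t a"
  shows "branch R' t' (\<theta> a)" "even a" "a \<notin> t"
proof -
  obtain x where x: "a \<notin> t" "x \<in> t" "(x, a) \<in> R" "infinite ((avoiding R t)\<^sup>* `` {a})"
    using assms unfolding branch_def by blast
  then show a: "even a" "a \<notin> t" using R_parity by (auto simp: t_def)
  have "\<theta> ` ((avoiding R t)\<^sup>* `` {a}) \<subseteq> (avoiding R' t')\<^sup>* `` {\<theta> a}"
    using avoiding_theta a by auto
  moreover have "inj_on \<theta> ((avoiding R t)\<^sup>* `` {a})" using inj_theta by (auto intro: inj_onI)
  ultimately have "infinite ((avoiding R' t')\<^sup>* `` {\<theta> a})"
    using x(4) finite_imageD finite_subset by blast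
  then show "branch R' t' (\<theta> a)"
    using window_adj[OF x(3,2,1)] theta_t'[OF x(1)] unfolding branch_def by metis
qed

text \<open>Each of the three clusters supplies one branch of the old window. A path off the new
  window between the images of two of them would pull back under \<open>\<theta>\<close> and join
  their clusters.\<close>

lemma surgery_trifurcation:
  assumes "x \<in> t" "y \<in> t" "z \<in> t"
    and inf: "infinite (R\<^sup>* `` {x})" "infinite (R\<^sup>* `` {y})" "infinite (R\<^sup>* `` {z})"
    and "(x, y) \<notin> R\<^sup>*" "(x, z) \<notin> R\<^sup>*" "(y, z) \<notin> R\<^sup>*"
  shows "trifurcation R' t'"
proof -
  have deg: "finite (R `` {x})" for x
    unfolding R_def by (rule gap_adj_finite_degree; rule signs_excise) (rule signs1 signs2)+
  obtain a b c where br: "branch R t a" "branch R t b" "branch R t c"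
    and p: "(x, a) \<in> R\<^sup>*" "(y, b) \<in> R\<^sup>*" "(z, c) \<in> R\<^sup>*"
    using infinite_cluster_branch[OF sym_R deg finite_t] assms(1-3) inf by metis
  have sep: "(\<theta> v, \<theta> w) \<notin> (avoiding R' t')\<^sup>*"
    if "branch R t v" "(u, v) \<in> R\<^sup>*" "(u', w) \<in> R\<^sup>*" "(u, u') \<notin> R\<^sup>*" for u u' v w
  proof
    assume "(\<theta> v, \<theta> w) \<in> (avoiding R' t')\<^sup>*"
    then have "(v, w) \<in> (avoiding R t)\<^sup>*"
      using avoiding_theta_rev[of v "\<theta> w"] branch_theta[OF that(1)] inj_theta by blast
    then have "(v, w) \<in> R\<^sup>*" using avoiding_subset by blast
    moreover have "(w, u') \<in> R\<^sup>*" using that(3) sym_rtrancl[OF sym_R] by (meson symD)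
    ultimately show False using that(2,4) by (meson rtrancl_trans)
  qed
  show ?thesis unfolding trifurcation_def
    using hub_window branch_theta(1)[OF br(1)] branch_theta(1)[OF br(2)] branch_theta(1)[OF br(3)]
      sep[OF br(1) p(1,2)] sep[OF br(1) p(1,3)] sep[OF br(2) p(2,3)] assms(7-9) by blast
qed

text \<open>An infinite even cluster missing \<open>t'\<close> would pull back into an infinite
  cluster of \<open>R\<close>, which meets \<open>t\<close>; the edge by which a path enters
  \<open>t\<close> yields an edge into \<open>t'\<close>, a contradiction. So all infinite even
  clusters meet \<open>t'\<close>, which is connected.\<close>

lemma surgery_unique:
  assumes meet: "\<And>x. even x \<Longrightarrow> infinite (R\<^sup>* `` {x}) \<Longrightarrow> \<exists>y\<in>t. (x, y) \<in> R\<^sup>*"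
  shows "unique_cluster \<nu>\<^sub>1 \<nu>\<^sub>2 0"
proof -
  have meet': "\<exists>w\<in>t'. (x, w) \<in> R'\<^sup>*" if x: "even x" "infinite (R'\<^sup>* `` {x})" for x
  proof (rule ccontr)
    assume no: "\<not> (\<exists>w\<in>t'. (x, w) \<in> R'\<^sup>*)"
    have out: "(x, y) \<in> (avoiding R' t')\<^sup>*" if "(x, y) \<in> R'\<^sup>*" for y
      using that
    proof induction
      case (step y z)
      then have "(x, z) \<in> R'\<^sup>*" by simp
      then show ?case using no step by (auto simp: avoiding_def intro: rtrancl_into_rtrancl)
    qed simp
    have "x \<notin> t'" using no by blast
    then obtain u where u: "x = \<theta> u" "even u" "u \<notin> t" using theta_surj x(1) by metis
    have "R'\<^sup>* `` {x} \<subseteq> \<theta> ` (R\<^sup>* `` {u})"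
      using out avoiding_theta_rev[of u] u avoiding_subset by blast
    then have "infinite (R\<^sup>* `` {u})" using x(2) finite_subset by blast
    then obtain y where "y \<in> t" "(u, y) \<in> R\<^sup>*" using meet u by blast
    then obtain p w where pw: "(u, p) \<in> (avoiding R t)\<^sup>*" "(p, w) \<in> R" "p \<notin> t" "w \<in> t"
      using first_hit[of u y R t] u(3) by blast
    obtain w' where w': "w' \<in> t'" "(w', \<theta> p) \<in> R'"
      using window_adj[OF symD[OF sym_R pw(2)] pw(4,3)] by blast
    have "(x, \<theta> p) \<in> R'\<^sup>*" using avoiding_theta[OF pw(1)] u avoiding_subset by blast
    then have "(x, w') \<in> R'\<^sup>*" using symD[OF sym_R' w'(2)] by simp
    then show False using no w'(1) by blast
  qed
  have inside: "(v, w) \<in> R'\<^sup>*" if "v \<in> t'" "w \<in> t'" for v w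
    using hub_window that rtrancl_mono[of "R' \<inter> t' \<times> t'" R'] unfolding hub_def by blast
  have "(x, y) \<in> R'\<^sup>*"
    if xy: "even x" "even y" "infinite (R'\<^sup>* `` {x})" "infinite (R'\<^sup>* `` {y})" for x y
  proof -
    obtain v w where "v \<in> t'" "w \<in> t'" "(x, v) \<in> R'\<^sup>*" "(y, w) \<in> R'\<^sup>*" using meet' xy by meson
    then show ?thesis using inside sym_rtrancl[OF sym_R'] by (meson rtrancl_trans symD)
  qed
  then show ?thesis by (simp add: unique_cluster_def gap_cluster_def R'_def)
qed

end

section \<open>Coin tossing\<close>

definition coin :: "bool measure" where
  "coin = measure_pmf (pmf_of_set UNIV)"

definition coins :: "('i \<Rightarrow> bool) measure" where
  "coins = Pi\<^sub>M UNIV (\<lambda>_. coin)"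

definition cylinder :: "'i set \<Rightarrow> ('i \<Rightarrow> bool set) \<Rightarrow> ('i \<Rightarrow> bool) set" where
  "cylinder J F = {\<omega>. \<forall>j\<in>J. \<omega> j \<in> F j}"

lemma prob_space_coin: "prob_space coin"
  by (simp add: coin_def prob_space_measure_pmf)

lemma space_coin [simp]: "space coin = UNIV" and sets_coin [simp]: "sets coin = UNIV"
  by (simp_all add: coin_def)

lemma measurable_coin: "measurable M coin = measurable M (count_space UNIV)"
  by (rule measurable_cong_sets) simp_all

lemma measure_coin: "measure coin A = card A / 2"
  by (simp add: coin_def measure_pmf_of_set)

lemma emeasure_coin: "emeasure coin A = ennreal (card A / 2)"
proof -
  interpret prob_space coin by (rule prob_space_coin)
  show ?thesis by (simp add: emeasure_eq_measure measure_coin)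
qed

interpretation coins: product_prob_space "\<lambda>_. coin" "UNIV :: 'i set"
  by (intro product_prob_spaceI prob_space_coin)

lemma prob_space_coins: "prob_space coins"
  by (simp add: coins_def prob_space_PiM prob_space_coin)

interpretation C: prob_space "coins :: ('i \<Rightarrow> bool) measure"
  by (rule prob_space_coins)

lemma space_coins [simp]: "space coins = UNIV"
  by (simp add: coins_def space_PiM)

lemma cylinder_emb: "cylinder J F = prod_emb UNIV (\<lambda>_. coin) J (Pi\<^sub>E J F)"
  by (auto simp: cylinder_def prod_emb_def PiE_def Pi_def)

lemma sets_cylinder: "finite J \<Longrightarrow> cylinder J F \<in> sets coins"
  unfolding cylinder_emb coins_def by (rule sets_PiM_I) auto

lemma measure_cylinder: "finite J \<Longrightarrow> measure coins (cylinder J F) = (\<Prod>j\<in>J. card (F j) / 2)"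
  unfolding cylinder_emb coins_def by (subst coins.measure_PiM_emb) (auto simp: measure_coin)

lemma coins_eqI:
  assumes "sets N = sets coins"
    "\<And>J F. finite J \<Longrightarrow> emeasure N (cylinder J F) = ennreal (\<Prod>j\<in>J. card (F j) / 2)"
  shows "N = coins"
  unfolding coins_def
proof (rule coins.PiM_eq)
  show "sets N = sets (Pi\<^sub>M UNIV (\<lambda>_. coin))" using assms(1) by (simp add: coins_def)
  fix J :: "'a set" and F :: "'a \<Rightarrow> bool set"
  assume J: "finite J"
  show "emeasure N (prod_emb UNIV (\<lambda>_. coin) J (Pi\<^sub>E J F)) = (\<Prod>j\<in>J. emeasure coin (F j))"
    using assms(2)[OF J, of F] unfolding cylinder_emb emeasure_coin by (subst prod_ennreal) auto
qed

lemma measurable_coins_component [measurable]: "(\<lambda>\<omega>. \<omega> i) \<in> measurable coins (count_space UNIV)"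
  unfolding coins_def measurable_coin[symmetric] by (rule measurable_component_singleton) simp

lemma measurable_coinsI:
  assumes "\<And>i. (\<lambda>w. h w i) \<in> measurable N (count_space UNIV)"
  shows "h \<in> measurable N coins"
  unfolding coins_def
  by (rule measurable_PiM_single') (use assms in \<open>auto simp: measurable_coin\<close>)

lemma coins_map_measurable: "(\<lambda>\<omega> i. \<omega> (g i) \<noteq> s i) \<in> measurable coins coins"
  by (rule measurable_coinsI) measurable

text \<open>On booleans \<open>\<noteq>\<close> is exclusive or: coordinates are read along
  \<open>g\<close> and flipped where \<open>s\<close> holds. As \<open>g\<close> is merely
  injective, the map may forget coins, so translations, flips and the deletion of inserted coins are
  all instances.\<close>

lemma distr_coins_map:
  assumes "inj g"
  shows "distr coins coins (\<lambda>\<omega> i. \<omega> (g i) \<noteq> s i) = coins"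
proof (rule coins_eqI)
  fix J :: "'a set" and F :: "'a \<Rightarrow> bool set" assume J: "finite J"
  define F' where "F' k = {b. (b \<noteq> s (inv g k)) \<in> F (inv g k)}" for k
  have pre: "(\<lambda>\<omega> i. \<omega> (g i) \<noteq> s i) -` cylinder J F \<inter> space coins = cylinder (g ` J) F'"
    using assms by (auto simp: cylinder_def F'_def)
  have "card (F' (g j)) = card (F j)" for j
  proof -
    have "F' (g j) = (\<lambda>b. b \<noteq> s j) -` F j" using assms by (simp add: F'_def vimage_def)
    moreover have "bij (\<lambda>b. b \<noteq> s j)" by (rule involuntory_imp_bij) auto
    ultimately show ?thesis by (simp add: card_vimage_inj bij_is_inj bij_is_surj)
  qed
  then have "(\<Prod>j\<in>g ` J. card (F' j) / 2) = (\<Prod>j\<in>J. real (card (F j)) / 2)"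
    using assms by (subst prod.reindex) (auto intro: inj_on_subset)
  then show "emeasure (distr coins coins (\<lambda>\<omega> i. \<omega> (g i) \<noteq> s i)) (cylinder J F) =
      ennreal (\<Prod>j\<in>J. real (card (F j)) / 2)"
    unfolding emeasure_distr[OF coins_map_measurable sets_cylinder[OF J]] pre
    using J by (simp add: C.emeasure_eq_measure measure_cylinder)
qed simp

lemma prob_coins_map:
  assumes "inj g" "A \<in> sets coins"
  shows "measure coins {\<omega>. (\<lambda>i. \<omega> (g i) \<noteq> s i) \<in> A} = measure coins A"
proof -
  have "measure (distr coins coins (\<lambda>\<omega> i. \<omega> (g i) \<noteq> s i)) A = measure coins {\<omega>. (\<lambda>i. \<omega> (g i) \<noteq> s i) \<in> A}"
    using assms(2) by (subst measure_distr[OF coins_map_measurable]) (auto simp: vimage_def)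
  then show ?thesis unfolding distr_coins_map[OF assms(1)] by simp
qed

lemma prob_coins_reindex:
  assumes "inj g" "A \<in> sets coins"
  shows "measure coins {\<omega>. (\<lambda>i. \<omega> (g i)) \<in> A} = measure coins A"
  using prob_coins_map[OF assms, of "\<lambda>_. False"] by simp

lemma measurable_reindex [measurable]: "(\<lambda>\<omega> i. \<omega> (g i)) \<in> measurable coins coins"
  by (rule measurable_coinsI) measurable

text \<open>Every assignment on \<open>J\<close> compatible with \<open>Q\<close> contributes one
  cylinder, and there are finitely many assignments.\<close>

lemma sets_coins_finite_dep:
  assumes "finite J" "\<And>\<omega> \<omega>'. (\<And>j. j \<in> J \<Longrightarrow> \<omega> j = \<omega>' j) \<Longrightarrow> Q \<omega> \<Longrightarrow> Q \<omega>'"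
  shows "{\<omega>. Q \<omega>} \<in> sets coins"
proof -
  define G where "G = {f \<in> Pi\<^sub>E J (\<lambda>_. UNIV :: bool set). \<exists>\<omega>. Q \<omega> \<and> (\<forall>j\<in>J. \<omega> j = f j)}"
  have "finite G" unfolding G_def using assms(1) by (intro finite_subset[OF _ finite_PiE]) auto
  moreover have "{\<omega>. Q \<omega>} = (\<Union>f\<in>G. cylinder J (\<lambda>j. {f j}))"
  proof (intro set_eqI iffI)
    fix \<omega> assume "\<omega> \<in> {\<omega>. Q \<omega>}"
    then have "restrict \<omega> J \<in> G" by (auto simp: G_def)
    then show "\<omega> \<in> (\<Union>f\<in>G. cylinder J (\<lambda>j. {f j}))"
      by (rule UN_I) (simp add: cylinder_def)
  next
    fix \<omega> assume "\<omega> \<in> (\<Union>f\<in>G. cylinder J (\<lambda>j. {f j}))"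
    then obtain \<omega>' where "Q \<omega>'" "\<And>j. j \<in> J \<Longrightarrow> \<omega>' j = \<omega> j" by (auto simp: cylinder_def G_def)
    then show "\<omega> \<in> {\<omega>. Q \<omega>}" using assms(2) by auto
  qed
  ultimately show ?thesis using assms(1) sets_cylinder by (metis (no_types, lifting) sets.finite_UN)
qed

text \<open>Finite energy of fair coins. Forcing one coin either changes nothing or flips it, and
  flips preserve the measure; so the probability that the forced configuration lies in
  \<open>A\<close> is at most twice that of \<open>A\<close>. Iterate over \<open>K\<close>.\<close>

lemma prob_override_pos:
  fixes f :: "'i \<Rightarrow> bool"
  assumes "finite K" "A \<in> sets coins" "measure coins {\<omega>. override_on \<omega> f K \<in> A} > 0"
  shows "measure coins A > 0"
  using assms
proof (induction K arbitrary: A rule: finite_induct)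
  case empty
  then show ?case by simp
next
  case (insert k K)
  define A' where "A' = {\<omega>. fun_upd \<omega> k (f k) \<in> A}"
  have upd: "(\<lambda>\<omega>. fun_upd \<omega> k (f k)) \<in> measurable coins coins"
    by (rule measurable_coinsI) (auto simp: fun_upd_def)
  have A': "A' \<in> sets coins"
    using measurable_sets[OF upd insert.prems(1)] by (simp add: A'_def vimage_def)
  have "{\<omega>. override_on \<omega> f (insert k K) \<in> A} = {\<omega>. override_on \<omega> f K \<in> A'}"
    by (simp add: A'_def override_on_insert)
  then have pos: "measure coins A' > 0" using insert.IH[OF A'] insert.prems(2) by simp
  define flip where "flip \<omega> = (\<lambda>i. \<omega> i \<noteq> (i = k))" for \<omega> :: "'i \<Rightarrow> bool"
  have B: "{\<omega>. flip \<omega> \<in> A} \<in> sets coins"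
    using measurable_sets[OF coins_map_measurable[of "\<lambda>i. i" "\<lambda>i. i = k"] insert.prems(1)]
    by (simp add: flip_def vimage_def)
  have "A' \<subseteq> A \<union> {\<omega>. flip \<omega> \<in> A}"
  proof
    fix \<omega> assume \<omega>: "\<omega> \<in> A'"
    show "\<omega> \<in> A \<union> {\<omega>. flip \<omega> \<in> A}"
    proof (cases "\<omega> k = f k")
      case True
      then have "fun_upd \<omega> k (f k) = \<omega>" by (simp add: fun_upd_idem)
      then show ?thesis using \<omega> by (simp add: A'_def)
    next
      case False
      then have "fun_upd \<omega> k (f k) = flip \<omega>" by (intro ext) (auto simp: flip_def)
      then show ?thesis using \<omega> by (simp add: A'_def)
    qed
  qed
  then have "measure coins A' \<le> measure coins (A \<union> {\<omega>. flip \<omega> \<in> A})"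
    using B insert.prems(1) by (intro C.finite_measure_mono) auto
  also have "\<dots> \<le> measure coins A + measure coins {\<omega>. flip \<omega> \<in> A}"
    using B insert.prems(1) by (intro measure_Un_le) auto
  also have "measure coins {\<omega>. flip \<omega> \<in> A} = measure coins A"
    using prob_coins_map[of "\<lambda>i. i", OF _ insert.prems(1)] by (simp add: flip_def)
  finally show ?case using pos by simp
qed

section \<open>Mixing and ergodicity of translations\<close>

lemma sets_coins_eq: "sets coins = sigma_sets UNIV {cylinder J F |J F. finite J}"
proof
  have "sets coins = sigma_sets UNIV (prod_algebra UNIV (\<lambda>_. coin))"
    by (simp add: coins_def sets_PiM)
  also have "\<dots> \<subseteq> sigma_sets UNIV {cylinder J F |J F. finite J}"
    by (rule sigma_sets_mono') (auto simp: prod_algebra_def cylinder_emb)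
  finally show "sets coins \<subseteq> sigma_sets UNIV {cylinder J F |J F. finite J}" .
  have "sigma_sets (space coins) {cylinder J F |J F. finite J} \<subseteq> sets coins"
    by (rule sets.sigma_sets_subset) (auto simp: sets_cylinder)
  then show "sigma_sets UNIV {cylinder J F |J F. finite J} \<subseteq> sets coins" by simp
qed

lemma Int_stable_cylinder: "Int_stable {cylinder J F |J F. finite J}"
proof (rule Int_stableI)
  fix A B :: "('a \<Rightarrow> bool) set"
  assume "A \<in> {cylinder J F |J F. finite J}" "B \<in> {cylinder J F |J F. finite J}"
  then obtain J F J' F' where *: "A = cylinder J F" "finite J" "B = cylinder J' F'" "finite J'" by auto
  have "A \<inter> B = cylinder (J \<union> J')
      (\<lambda>j. (if j \<in> J then F j else UNIV) \<inter> (if j \<in> J' then F' j else UNIV))"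
    by (auto simp: * cylinder_def)
  then show "A \<inter> B \<in> {cylinder J F |J F. finite J}" using * by blast
qed

text \<open>The events asymptotically independent of \<open>X n\<close> form a Dynkin system. For
  disjoint unions the limit passes through the series by Tannery's theorem, with the summable
  majorant \<open>measure coins (A i)\<close>.\<close>

lemma mixing_extend:
  assumes X: "\<And>n. X n \<in> sets coins"
    and cyl: "\<And>J F. finite J \<Longrightarrow>
      (\<lambda>n. measure coins (cylinder J F \<inter> X n)) \<longlonglongrightarrow> measure coins (cylinder J F) * c"
    and c: "\<And>n. measure coins (X n) = c"
    and A: "A \<in> sets coins"
  shows "(\<lambda>n::nat. measure coins (A \<inter> X n)) \<longlonglongrightarrow> measure coins A * c"
proof -
  have "{cylinder J F |J F. finite J} \<subseteq> Pow (UNIV :: ('i \<Rightarrow> bool) set)" by simp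
  from Int_stable_cylinder this A[unfolded sets_coins_eq] show ?thesis
  proof (induction A rule: sigma_sets_induct_disjoint)
    case (basic A)
    then show ?case using cyl by auto
  next
    case empty
    then show ?case by simp
  next
    case (compl A)
    then have A: "A \<in> sets coins" by (simp add: sets_coins_eq)
    have 1: "measure coins ((UNIV - A) \<inter> X n) = c - measure coins (A \<inter> X n)" for n
    proof -
      have "(UNIV - A) \<inter> X n = X n - A \<inter> X n" by auto
      then show ?thesis using C.finite_measure_Diff[OF X, of "A \<inter> X n" n] A X c by auto
    qed
    have 2: "measure coins (UNIV - A) = 1 - measure coins A"
      using C.prob_compl[OF A] by simp
    have "(\<lambda>n. c - measure coins (A \<inter> X n)) \<longlonglongrightarrow> c - measure coins A * c"
      by (intro tendsto_intros compl)
    then show ?case by (simp add: 1 2 algebra_simps)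
  next
    case (union A)
    then have A: "A i \<in> sets coins" for i by (auto simp: sets_coins_eq)
    have sm: "(\<lambda>i. measure coins (A i)) sums measure coins (\<Union>i. A i)"
      using A union(1) by (intro C.finite_measure_UNION) auto
    have 1: "measure coins ((\<Union>i. A i) \<inter> X n) = (\<Sum>i. measure coins (A i \<inter> X n))" for n
    proof -
      have disj: "disjoint_family (\<lambda>i. A i \<inter> X n)"
        using union(1) unfolding disjoint_family_on_def by blast
      have "(\<lambda>i. measure coins (A i \<inter> X n)) sums measure coins (\<Union>i. A i \<inter> X n)"
        using A X disj by (intro C.finite_measure_UNION) auto
      then show ?thesis by (simp add: sums_iff)
    qed
    have "(\<lambda>n. \<Sum>i. measure coins (A i \<inter> X n)) \<longlonglongrightarrow> (\<Sum>i. measure coins (A i) * c)"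
    proof (rule tannerys_theorem[THEN conjunct2, THEN conjunct2])
      show "(\<lambda>n. measure coins (A i \<inter> X n)) \<longlonglongrightarrow> measure coins (A i) * c" for i by (rule union)
      show "\<forall>\<^sub>F (i, n) in at_top \<times>\<^sub>F sequentially. norm (measure coins (A i \<inter> X n)) \<le> measure coins (A i)"
        using A X by (intro always_eventually) (auto intro!: C.finite_measure_mono)
      show "summable (\<lambda>i. measure coins (A i))" using sm by (rule sums_summable)
    qed simp
    moreover have "(\<Sum>i. measure coins (A i) * c) = measure coins (\<Union>i. A i) * c"
      using sums_mult2[OF sm] by (simp add: sums_iff)
    ultimately show ?case by (simp add: 1)
  qed
qed

text \<open>The index flag is \<open>True\<close> for the upper sequence and \<open>False\<close>
  for the lower one.\<close>

type_synonym config = "bool \<times> int \<Rightarrow> bool"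

definition translate :: "int \<Rightarrow> config \<Rightarrow> config" where
  "translate n \<omega> = (\<lambda>i. \<omega> (fst i, snd i + n))"

lemma inj_translate_index: "inj (\<lambda>i. (fst i, snd i + n :: int))"
  by (auto intro!: injI prod_eqI)

lemma measurable_translate [measurable]: "translate n \<in> measurable coins coins"
  unfolding translate_def[abs_def] by (rule measurable_reindex)

lemma prob_translate: "A \<in> sets coins \<Longrightarrow> measure coins (translate n -` A) = measure coins A"
  using prob_coins_reindex[OF inj_translate_index[of n]] by (simp add: translate_def vimage_def)

lemma sets_translate: "A \<in> sets coins \<Longrightarrow> translate n -` A \<in> sets coins"
  using measurable_sets[OF measurable_translate, of A n] by simp

lemma translate_translate: "translate m (translate n \<omega>) = translate (m + n) \<omega>"
  by (simp add: translate_def add.assoc)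

lemma translate_0: "translate 0 \<omega> = \<omega>"
  by (simp add: translate_def)

text \<open>For large \<open>n\<close> the shifted index set is disjoint from \<open>J\<close>, and
  from then on the two events are exactly independent.\<close>

lemma mixing_cylinder:
  assumes "finite J" "finite J'"
  shows "(\<lambda>n. measure coins (cylinder J F \<inter> translate (2 * int n) -` cylinder J' F')) \<longlonglongrightarrow>
    measure coins (cylinder J F) * measure coins (cylinder J' F')"
proof -
  define sh where "sh n = (\<lambda>i. (fst i :: bool, snd i + 2 * int n))" for n
  have inj: "inj (sh n)" for n unfolding sh_def by (rule inj_translate_index)
  have "\<forall>\<^sub>F n in sequentially. \<forall>j\<in>J. \<forall>j'\<in>J'. j \<noteq> sh n j'"
  proof (intro eventually_ball_finite assms ballI)
    fix j j' :: "bool \<times> int"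
    show "\<forall>\<^sub>F n in sequentially. j \<noteq> sh n j'"
      using eventually_gt_at_top[of "nat (snd j - snd j')"] by eventually_elim (auto simp: sh_def)
  qed
  then have "\<forall>\<^sub>F n in sequentially. measure coins (cylinder J F \<inter> translate (2 * int n) -` cylinder J' F') =
      measure coins (cylinder J F) * measure coins (cylinder J' F')"
  proof eventually_elim
    case (elim n)
    define G where "G k = (if k \<in> J then F k else F' (inv (sh n) k))" for k
    have disj: "J \<inter> sh n ` J' = {}" using elim by blast
    have G: "G (sh n j) = F' j" if "j \<in> J'" for j using that disj inj[of n] by (auto simp: G_def)
    have "cylinder J F \<inter> translate (2 * int n) -` cylinder J' F' = cylinder (J \<union> sh n ` J') G"
    proof -
      have "\<omega> \<in> translate (2 * int n) -` cylinder J' F' \<longleftrightarrow> (\<forall>k\<in>sh n ` J'. \<omega> k \<in> G k)" for \<omega>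
        using G by (auto simp: cylinder_def translate_def sh_def)
      then show ?thesis by (auto simp: cylinder_def G_def)
    qed
    then show ?case
      using assms disj inj[of n] G by (simp add: measure_cylinder prod.union_disjoint prod.reindex
          inj_on_subset[OF _ subset_UNIV] G_def[abs_def] cong: prod.cong_simp)
  qed
  then show ?thesis by (rule tendsto_eventually)
qed

text \<open>The extension from cylinders treats one event at a time; translation invariance
  exchanges the roles of \<open>A\<close> and \<open>B\<close> at the price of reversing the
  shift.\<close>

lemma mixing:
  assumes A: "A \<in> sets coins" and B: "B \<in> sets coins"
  shows "(\<lambda>n. measure coins (A \<inter> translate (2 * int n) -` B)) \<longlonglongrightarrow> measure coins A * measure coins B"
proof -
  have 1: "(\<lambda>n. measure coins (A \<inter> translate (2 * int n) -` cylinder J F)) \<longlonglongrightarrow>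
      measure coins A * measure coins (cylinder J F)" if J: "finite J" for J F
    by (rule mixing_extend)
      (use J A mixing_cylinder in \<open>auto simp: sets_translate sets_cylinder prob_translate\<close>)
  have sw: "measure coins (A \<inter> translate k -` B) = measure coins (B \<inter> translate (- k) -` A)"
    if "A \<in> sets coins" "B \<in> sets coins" for A B k
  proof -
    have "measure coins (B \<inter> translate (- k) -` A) = measure coins (translate k -` (B \<inter> translate (- k) -` A))"
      using prob_translate[of "B \<inter> translate (- k) -` A" k] that sets_translate by simp
    also have "translate k -` (B \<inter> translate (- k) -` A) = A \<inter> translate k -` B"
      by (auto simp: translate_translate translate_0)
    finally show ?thesis by simp
  qed
  have "(\<lambda>n. measure coins (B \<inter> translate (- (2 * int n)) -` A)) \<longlonglongrightarrow> measure coins B * measure coins A"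
  proof (rule mixing_extend)
    fix J :: "(bool \<times> int) set" and F assume J: "finite J"
    show "(\<lambda>n. measure coins (cylinder J F \<inter> translate (- (2 * int n)) -` A)) \<longlonglongrightarrow>
        measure coins (cylinder J F) * measure coins A"
      using 1[OF J, of F] sw[OF A sets_cylinder[OF J]] by (simp add: mult.commute)
  qed (use A B in \<open>auto simp: sets_translate prob_translate\<close>)
  then show ?thesis using sw[OF A B] by (simp add: mult.commute)
qed

text \<open>For an invariant event, mixing with itself gives \<open>p = p * p\<close>. The shift is
  by 2 because a unit shift exchanges even and odd gaps and so does not respect events about one
  parity.\<close>

lemma ergodic:
  assumes A: "A \<in> sets coins" and inv: "translate 2 -` A = A"
  shows "measure coins A = 0 \<or> measure coins A = 1"
proof -
  have "translate (2 * int n) -` A = A" for n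
  proof (induction n)
    case 0
    then show ?case by (auto simp: translate_0)
  next
    case (Suc n)
    have "translate (2 * int (Suc n)) -` A = translate (2 * int n) -` (translate 2 -` A)"
      by (auto simp: translate_translate algebra_simps)
    then show ?case using Suc inv by simp
  qed
  then have "(\<lambda>n. measure coins A) \<longlonglongrightarrow> measure coins A * measure coins A"
    using mixing[OF A A] by simp
  then have "measure coins A = measure coins A * measure coins A"
    using LIMSEQ_unique tendsto_const by blast
  then show ?thesis by (simp add: algebra_simps)
qed

section \<open>Events and their translates\<close>

definition spin :: "bool \<Rightarrow> config \<Rightarrow> int \<Rightarrow> int" where
  "spin b \<omega> x = (if \<omega> (b, x) then 1 else -1)"

definition gaps :: "config \<Rightarrow> (int \<times> int) set" where
  "gaps \<omega> = gap_adj (spin True \<omega>) (spin False \<omega>)"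

lemma signs_spin: "signs (spin b \<omega>)"
  by (simp add: signs_def spin_def)

lemma sym_gaps: "sym (gaps \<omega>)"
  by (simp add: gaps_def sym_gap_adj)

lemma spin_translate: "spin b (translate n \<omega>) x = spin b \<omega> (x + n)"
  by (simp add: spin_def translate_def)

section \<open>Measurability of the events\<close>

lemma paired_cong:
  assumes "\<And>k. x \<le> k \<Longrightarrow> k \<le> y \<Longrightarrow> \<epsilon> k = \<epsilon>' k" "paired \<epsilon> x y"
  shows "paired \<epsilon>' x y"
proof -
  have s: "(\<Sum>k=x..z. \<epsilon>' k) = (\<Sum>k=x..z. \<epsilon> k)" if "z \<le> y" for z
    using that assms(1) by (intro sum.cong) auto
  have "y \<le> z" if z: "z \<in> return_points \<epsilon>' x" for z
  proof (rule ccontr)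
    assume "\<not> y \<le> z"
    then have "z \<in> return_points \<epsilon> x" using z s[of z] by (simp add: return_points_def)
    then show False using assms(2) \<open>\<not> y \<le> z\<close> by (auto simp: paired_def)
  qed
  moreover have "\<epsilon> x = 1" "y \<in> return_points \<epsilon> x" using assms(2) by (auto simp: paired_def)
  moreover from this have "x \<le> y" by (simp add: return_points_def)
  then have "\<epsilon>' x = \<epsilon> x" using assms(1)[of x] by simp
  ultimately show ?thesis using s[of y] by (simp add: paired_def return_points_def)
qed

text \<open>Pairing of \<open>x\<close> with \<open>y\<close> depends only on the signs between
  them, as any earlier return also lies there; so finitely many coins decide it.\<close>

lemma measurable_paired [measurable]: "Measurable.pred coins (\<lambda>\<omega>. paired (spin b \<omega>) x y)"
proof -
  have "{\<omega>. paired (spin b \<omega>) x y} \<in> sets coins"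
  proof (rule sets_coins_finite_dep)
    show "finite (Pair b ` {x..y})" by simp
    fix \<omega> \<omega>' :: config
    assume eq: "\<And>j. j \<in> Pair b ` {x..y} \<Longrightarrow> \<omega> j = \<omega>' j" and "paired (spin b \<omega>) x y"
    have "spin b \<omega> k = spin b \<omega>' k" if "x \<le> k" "k \<le> y" for k
      using eq[of "(b, k)"] that by (simp add: spin_def)
    then show "paired (spin b \<omega>') x y" using \<open>paired (spin b \<omega>) x y\<close> by (rule paired_cong)
  qed
  then show ?thesis by (simp add: pred_def)
qed

lemma pred_constant: "Measurable.pred M (\<lambda>_. c)"
  by simp

lemmas pred_rules = pred_intros_countable pred_intros_logic(2-5) pred_constant

lemma measurable_gaps: "Measurable.pred coins (\<lambda>\<omega>. (x, y) \<in> gaps \<omega>)"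
  unfolding gaps_def gap_adj_def gap_edge_def mem_Collect_eq case_prod_conv
  by (intro pred_rules measurable_paired)

lemma measurable_match_adj:
  "Measurable.pred coins (\<lambda>\<omega>. (x, y) \<in> match_adj (spin True \<omega>) (spin False \<omega>))"
  unfolding match_adj_def mem_Collect_eq case_prod_conv by (intro pred_rules measurable_paired)

text \<open>Reachability is a countable union over path lengths, and a path of given length is
  handled by a countable union over its last intermediate point.\<close>

lemma measurable_rtrancl:
  fixes R :: "'w \<Rightarrow> ('v :: countable \<times> 'v) set"
  assumes "\<And>x y. Measurable.pred N (\<lambda>\<omega>. (x, y) \<in> R \<omega>)"
  shows "Measurable.pred N (\<lambda>\<omega>. (x, y) \<in> (R \<omega>)\<^sup>*)"
proof -
  have pow: "Measurable.pred N (\<lambda>\<omega>. (x, y) \<in> R \<omega> ^^ n)" for n x y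
  proof (induction n arbitrary: y)
    case 0
    show ?case unfolding relpow.simps pair_in_Id_conv by (rule pred_constant)
  next
    case (Suc n)
    show ?case unfolding relpow.simps relcomp_unfold mem_Collect_eq case_prod_conv
      by (intro pred_rules Suc.IH assms)
  qed
  show ?thesis unfolding rtrancl_power by (intro pred_rules pow)
qed

lemma measurable_infinite_class:
  fixes R :: "'w \<Rightarrow> (int \<times> int) set"
  assumes "\<And>x y. Measurable.pred N (\<lambda>\<omega>. (x, y) \<in> R \<omega>)"
  shows "Measurable.pred N (\<lambda>\<omega>. infinite ((R \<omega>)\<^sup>* `` {x}))"
  unfolding infinite_int_iff_unbounded Image_singleton_iff
  by (intro pred_rules measurable_rtrancl[OF assms])

lemma measurable_avoiding:
  fixes R :: "'w \<Rightarrow> (int \<times> int) set"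
  assumes "\<And>x y. Measurable.pred N (\<lambda>\<omega>. (x, y) \<in> R \<omega>)"
  shows "Measurable.pred N (\<lambda>\<omega>. (x, y) \<in> avoiding (R \<omega>) t)"
  unfolding avoiding_def Int_iff mem_Times_iff fst_conv snd_conv by (intro pred_rules assms)

lemma measurable_trifurcation: "Measurable.pred coins (\<lambda>\<omega>. trifurcation (gaps \<omega>) t)"
proof -
  have "Measurable.pred coins (\<lambda>\<omega>. (x, y) \<in> gaps \<omega> \<inter> t \<times> t)" for x y
    unfolding Int_iff mem_Times_iff fst_conv snd_conv by (intro pred_rules measurable_gaps)
  note inner = measurable_rtrancl[OF this]
  show ?thesis unfolding trifurcation_def hub_def branch_def Ball_def Bex_def
    by (intro pred_rules inner measurable_gaps measurable_rtrancl[OF measurable_avoiding[OF measurable_gaps]]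
        measurable_infinite_class[OF measurable_avoiding[OF measurable_gaps]])
qed

lemma measurable_unique:
  "Measurable.pred coins (\<lambda>\<omega>. unique_cluster (spin True \<omega>) (spin False \<omega>) r)"
  unfolding unique_cluster_def gap_cluster_def gaps_def[symmetric]
  by (intro pred_rules measurable_rtrancl[OF measurable_gaps] measurable_infinite_class[OF measurable_gaps])

section \<open>Covariance under translations\<close>

lemma paired_shift: "paired (\<lambda>k. \<epsilon> (k + n)) x y \<longleftrightarrow> paired \<epsilon> (x + n) (y + n)"
proof -
  have s: "(\<Sum>k=x..z. \<epsilon> (k + n)) = (\<Sum>k=x+n..z+n. \<epsilon> k)" for z
    by (rule sum.reindex_bij_witness[of _ "\<lambda>k. k - n" "\<lambda>k. k + n"]) auto
  have r: "z \<in> return_points (\<lambda>k. \<epsilon> (k + n)) x \<longleftrightarrow> z + n \<in> return_points \<epsilon> (x + n)" for z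
    by (simp add: return_points_def s)
  have "(\<forall>z\<in>return_points (\<lambda>k. \<epsilon> (k + n)) x. y \<le> z) \<longleftrightarrow> (\<forall>z\<in>return_points \<epsilon> (x + n). y + n \<le> z)"
  proof safe
    fix z assume a: "\<forall>z\<in>return_points (\<lambda>k. \<epsilon> (k + n)) x. y \<le> z" "z \<in> return_points \<epsilon> (x + n)"
    then show "y + n \<le> z" using r[of "z - n"] by force
  next
    fix z assume a: "\<forall>z\<in>return_points \<epsilon> (x + n). y + n \<le> z" "z \<in> return_points (\<lambda>k. \<epsilon> (k + n)) x"
    then show "y \<le> z" using r[of z] by force
  qed
  then show ?thesis by (simp add: paired_def r)
qed

lemma paired_translate: "paired (spin b (translate n \<omega>)) x y \<longleftrightarrow> paired (spin b \<omega>) (x + n) (y + n)"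
proof -
  have "spin b (translate n \<omega>) = (\<lambda>k. spin b \<omega> (k + n))" by (simp add: fun_eq_iff spin_translate)
  then show ?thesis by (simp add: paired_shift)
qed

lemma gaps_translate: "(x, y) \<in> gaps (translate n \<omega>) \<longleftrightarrow> (x + n, y + n) \<in> gaps \<omega>"
proof -
  have "x + 1 + n = x + n + 1" "y + 1 + n = y + n + 1" by simp_all
  then show ?thesis by (simp only: gaps_def gap_adj_def gap_edge_def paired_translate mem_Collect_eq case_prod_conv)
qed

lemma match_adj_translate:
  "(x, y) \<in> match_adj (spin True (translate n \<omega>)) (spin False (translate n \<omega>)) \<longleftrightarrow>
   (x + n, y + n) \<in> match_adj (spin True \<omega>) (spin False \<omega>)"
  by (simp add: match_adj_def paired_translate)

lemma rtrancl_translate: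
  fixes n :: int
  assumes "\<And>x y. (x, y) \<in> R' \<longleftrightarrow> (x + n, y + n) \<in> R"
  shows "(x, y) \<in> R'\<^sup>* \<longleftrightarrow> (x + n, y + n) \<in> R\<^sup>*"
proof
  assume "(x, y) \<in> R'\<^sup>*"
  then show "(x + n, y + n) \<in> R\<^sup>*"
  proof induction
    case (step y z)
    then show ?case using assms by (meson rtrancl.rtrancl_into_rtrancl)
  qed simp
next
  have "(x, v - n) \<in> R'\<^sup>*" if "(x + n, v) \<in> R\<^sup>*" for v
    using that
  proof induction
    case (step y z)
    then have "(y - n, z - n) \<in> R'" using assms by simp
    then show ?case using step by (meson rtrancl.rtrancl_into_rtrancl)
  qed simp
  from this[of "y + n"] show "(x + n, y + n) \<in> R\<^sup>* \<Longrightarrow> (x, y) \<in> R'\<^sup>*" by simp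
qed

lemma infinite_class_translate:
  fixes n :: int
  assumes "\<And>x y. (x, y) \<in> R' \<longleftrightarrow> (x + n, y + n) \<in> R"
  shows "infinite (R'\<^sup>* `` {x}) \<longleftrightarrow> infinite (R\<^sup>* `` {x + n})"
proof -
  have "R\<^sup>* `` {x + n} = (\<lambda>y. y + n) ` (R'\<^sup>* `` {x})"
  proof (intro set_eqI iffI)
    fix v assume "v \<in> R\<^sup>* `` {x + n}"
    then have "v - n \<in> R'\<^sup>* `` {x}" using rtrancl_translate[OF assms, of x "v - n"] by simp
    then show "v \<in> (\<lambda>y. y + n) ` (R'\<^sup>* `` {x})" by force
  next
    fix v assume "v \<in> (\<lambda>y. y + n) ` (R'\<^sup>* `` {x})"
    then show "v \<in> R\<^sup>* `` {x + n}" using rtrancl_translate[OF assms] by auto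
  qed
  then show ?thesis by (simp add: finite_image_iff inj_on_def)
qed

lemma trifurcation_translate:
  fixes n :: int
  assumes R: "\<And>x y. (x, y) \<in> R' \<longleftrightarrow> (x + n, y + n) \<in> R"
    and t: "\<And>x. x \<in> t' \<longleftrightarrow> x + n \<in> t"
  shows "trifurcation R' t' \<longleftrightarrow> trifurcation R t"
proof -
  have t_eq: "t' = (\<lambda>x. x - n) ` t"
  proof (rule set_eqI)
    show "x \<in> t' \<longleftrightarrow> x \<in> (\<lambda>x. x - n) ` t" for x
      unfolding t by (auto intro: image_eqI[where x = "x + n"])
  qed
  have av: "(x, y) \<in> avoiding R' t' \<longleftrightarrow> (x + n, y + n) \<in> avoiding R t" for x y
    by (simp add: avoiding_def R t)
  have inn: "(x, y) \<in> R' \<inter> t' \<times> t' \<longleftrightarrow> (x + n, y + n) \<in> R \<inter> t \<times> t" for x y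
    by (simp add: R t)
  have hub: "hub R' t' \<longleftrightarrow> hub R t"
  proof -
    have "hub R' t' \<longleftrightarrow> (\<forall>x\<in>t'. \<forall>y\<in>t'. (x + n, y + n) \<in> (R \<inter> t \<times> t)\<^sup>*)"
      unfolding hub_def rtrancl_translate[OF inn] ..
    also have "\<dots> \<longleftrightarrow> hub R t" unfolding hub_def t_eq by simp
    finally show ?thesis .
  qed
  have branch: "branch R' t' a \<longleftrightarrow> branch R t (a + n)" for a
  proof -
    have "(\<exists>x\<in>t'. (x, a) \<in> R') \<longleftrightarrow> (\<exists>x\<in>t'. (x + n, a + n) \<in> R)" unfolding R ..
    also have "\<dots> \<longleftrightarrow> (\<exists>x\<in>t. (x, a + n) \<in> R)" unfolding t_eq by simp
    finally show ?thesis unfolding branch_def infinite_class_translate[OF av] by (simp add: t)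
  qed
  define Q where "Q a b c \<longleftrightarrow> branch R t a \<and> branch R t b \<and> branch R t c \<and>
     (a, b) \<notin> (avoiding R t)\<^sup>* \<and> (a, c) \<notin> (avoiding R t)\<^sup>* \<and> (b, c) \<notin> (avoiding R t)\<^sup>*" for a b c
  have "(\<exists>a b c. Q (a + n) (b + n) (c + n)) \<longleftrightarrow> (\<exists>a b c. Q a b c)"
  proof
    assume "\<exists>a b c. Q a b c"
    then obtain a b c where "Q a b c" by blast
    then have "Q ((a - n) + n) ((b - n) + n) ((c - n) + n)" by simp
    then show "\<exists>a b c. Q (a + n) (b + n) (c + n)" by blast
  qed blast
  then show ?thesis
    unfolding trifurcation_def hub branch rtrancl_translate[OF av] Q_def by simp
qed

lemma gap_cluster_translate:
  "infinite (gap_cluster (spin True (translate n \<omega>)) (spin False (translate n \<omega>)) x) \<longleftrightarrow>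
   infinite (gap_cluster (spin True \<omega>) (spin False \<omega>) (x + n))"
  unfolding gap_cluster_def gaps_def[symmetric] by (rule infinite_class_translate[OF gaps_translate])

lemma unique_translate:
  "unique_cluster (spin True (translate n \<omega>)) (spin False (translate n \<omega>)) r \<longleftrightarrow>
   unique_cluster (spin True \<omega>) (spin False \<omega>) (r + n)"
proof -
  note path = rtrancl_translate[OF gaps_translate, unfolded gaps_def]
  define Q where "Q x y \<longleftrightarrow> (even (x - (r + n)) \<longrightarrow> even (y - (r + n)) \<longrightarrow>
     infinite (gap_cluster (spin True \<omega>) (spin False \<omega>) x) \<longrightarrow>
     infinite (gap_cluster (spin True \<omega>) (spin False \<omega>) y) \<longrightarrow>
     (x, y) \<in> (gap_adj (spin True \<omega>) (spin False \<omega>))\<^sup>*)" for x y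
  have "(\<forall>x y. Q (x + n) (y + n)) \<longleftrightarrow> (\<forall>x y. Q x y)"
  proof (intro iffI allI)
    fix x y assume "\<forall>x y. Q (x + n) (y + n)"
    then have "Q ((x - n) + n) ((y - n) + n)" by blast
    then show "Q x y" by simp
  qed blast
  then show ?thesis unfolding unique_cluster_def gap_cluster_translate path Q_def by simp
qed

lemma unique_parity: "even (r - s) \<Longrightarrow> unique_cluster \<epsilon> \<epsilon>' r = unique_cluster \<epsilon> \<epsilon>' s"
proof -
  assume "even (r - s)"
  then have "even (x - r) = even (x - s)" for x by auto
  then show ?thesis by (simp only: unique_cluster_def)
qed

section \<open>Surgery on the coin space\<close>

definition del_window :: "int \<Rightarrow> bool \<times> int \<Rightarrow> bool \<times> int" where
  "del_window m i = (fst i, shift_after (if fst i then m else 0) m (snd i))"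

text \<open>Reading \<open>\<tau>\<close> along \<open>del_window m\<close>, which sends old indices
  to new ones, forgets the inserted coins and again gives fair coins; the result thus lies in
  \<open>A\<close> with positive probability. Setting the finitely many forgotten coins to the
  alternating pattern produces a surgery, and \<open>prob_override_pos\<close> returns from forced
  to free coins.\<close>

lemma surgery_pos:
  assumes m: "even m" "0 \<le> m" and AB: "A \<in> sets coins" "B \<in> sets coins" "measure coins A > 0"
    and imp: "\<And>\<nu>. surgery (spin True \<nu>) (spin False \<nu>) m \<Longrightarrow> (\<lambda>i. \<nu> (del_window m i)) \<in> A \<Longrightarrow> \<nu> \<in> B"
  shows "measure coins B > 0"
proof -
  \<comment> \<open>The inserted coins, in the right half of the new window above and in its left
    half below. The values \<open>f\<close> are those demanded by \<open>block\<close>.\<close>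
  define K where "K = Pair True ` {m<..2 * m} \<union> Pair False ` {0<..m}"
  define f where "f i = odd (snd i)" for i :: "bool \<times> int"
  have inj: "inj (del_window m)"
  proof (rule injI)
    fix i j assume "del_window m i = del_window m j"
    then show "i = j" using m
      by (cases i; cases j) (auto simp: del_window_def shift_after_def split: if_splits)
  qed
  have K: "del_window m i \<notin> K" for i
    using m by (cases i) (auto simp: del_window_def K_def shift_after_def)
  have "override_on \<tau> f K \<in> B" if \<tau>: "(\<lambda>i. \<tau> (del_window m i)) \<in> A" for \<tau>
  proof (rule imp)
    show "(\<lambda>i. override_on \<tau> f K (del_window m i)) \<in> A" using \<tau> K by (simp add: override_on_def)
    show "surgery (spin True (override_on \<tau> f K)) (spin False (override_on \<tau> f K)) m"
    proof
      show "block m m (spin True (override_on \<tau> f K))"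
        by (auto simp: block_def spin_def override_on_def K_def f_def)
      show "block 0 m (spin False (override_on \<tau> f K))"
        by (auto simp: block_def spin_def override_on_def K_def f_def)
    qed (use m signs_spin in auto)
  qed
  then have sub: "{\<tau>. (\<lambda>i. \<tau> (del_window m i)) \<in> A} \<subseteq> {\<tau>. override_on \<tau> f K \<in> B}" by blast
  have meas: "(\<lambda>\<tau>. override_on \<tau> f K) \<in> measurable coins coins"
  proof (rule measurable_coinsI)
    show "(\<lambda>\<tau>. override_on \<tau> f K i) \<in> measurable coins (count_space UNIV)" for i
      by (cases "i \<in> K") simp_all
  qed
  have "{\<tau>. override_on \<tau> f K \<in> B} \<in> sets coins"
    using measurable_sets[OF meas AB(2)] by (simp add: vimage_def)
  then have "measure coins {\<tau>. (\<lambda>i. \<tau> (del_window m i)) \<in> A} \<le> measure coins {\<tau>. override_on \<tau> f K \<in> B}"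
    using sub by (intro C.finite_measure_mono)
  then have "measure coins {\<tau>. override_on \<tau> f K \<in> B} > 0"
    using prob_coins_reindex[OF inj AB(1)] AB(3) by simp
  then show ?thesis by (intro prob_override_pos[OF _ AB(2)]) (auto simp: K_def)
qed

lemma spin_del_window:
  "spin True (\<lambda>i. \<nu> (del_window m i)) = excise m m (spin True \<nu>)"
  "spin False (\<lambda>i. \<nu> (del_window m i)) = excise 0 m (spin False \<nu>)"
  by (rule ext, simp add: spin_def del_window_def excise_def shift_after_def)+

definition window :: "int \<Rightarrow> int \<Rightarrow> int set" where
  "window z l = {x. even x \<and> z \<le> x \<and> x \<le> z + l}"

definition three_clusters :: "int \<Rightarrow> config \<Rightarrow> bool" where
  "three_clusters m \<omega> \<longleftrightarrow> (\<exists>x y z. x \<in> window 0 m \<and> y \<in> window 0 m \<and> z \<in> window 0 m \<and>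
     infinite ((gaps \<omega>)\<^sup>* `` {x}) \<and> infinite ((gaps \<omega>)\<^sup>* `` {y}) \<and> infinite ((gaps \<omega>)\<^sup>* `` {z}) \<and>
     (x, y) \<notin> (gaps \<omega>)\<^sup>* \<and> (x, z) \<notin> (gaps \<omega>)\<^sup>* \<and> (y, z) \<notin> (gaps \<omega>)\<^sup>*)"

definition all_meet :: "int \<Rightarrow> config \<Rightarrow> bool" where
  "all_meet m \<omega> \<longleftrightarrow> (\<forall>x. even x \<longrightarrow> infinite ((gaps \<omega>)\<^sup>* `` {x}) \<longrightarrow>
     (\<exists>y. y \<in> window 0 m \<and> (x, y) \<in> (gaps \<omega>)\<^sup>*))"

lemma sets_three_clusters: "{\<omega>. three_clusters m \<omega>} \<in> sets coins"
  and sets_all_meet: "{\<omega>. all_meet m \<omega>} \<in> sets coins"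
  and sets_trifurcation: "{\<omega>. trifurcation (gaps \<omega>) t} \<in> sets coins"
  and sets_unique: "{\<omega>. unique_cluster (spin True \<omega>) (spin False \<omega>) r} \<in> sets coins"
proof -
  note meas = measurable_rtrancl[OF measurable_gaps] measurable_infinite_class[OF measurable_gaps]
  have "Measurable.pred coins (\<lambda>\<omega>. three_clusters m \<omega>)"
    unfolding three_clusters_def by (intro pred_rules meas)
  then show "{\<omega>. three_clusters m \<omega>} \<in> sets coins" by (simp add: pred_def)
  have "Measurable.pred coins (\<lambda>\<omega>. all_meet m \<omega>)"
    unfolding all_meet_def by (intro pred_rules meas)
  then show "{\<omega>. all_meet m \<omega>} \<in> sets coins" by (simp add: pred_def)
  show "{\<omega>. trifurcation (gaps \<omega>) t} \<in> sets coins"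
    "{\<omega>. unique_cluster (spin True \<omega>) (spin False \<omega>) r} \<in> sets coins"
    using measurable_trifurcation measurable_unique by (simp_all add: pred_def)
qed

lemma trifurcation_pos:
  assumes m: "even m" "0 \<le> m" and "measure coins {\<omega>. three_clusters m \<omega>} > 0"
  shows "measure coins {\<omega>. trifurcation (gaps \<omega>) (window 0 (2 * m))} > 0"
proof (rule surgery_pos[OF m sets_three_clusters sets_trifurcation assms(3)])
  fix \<nu> assume "surgery (spin True \<nu>) (spin False \<nu>) m"
  then interpret surgery "spin True \<nu>" "spin False \<nu>" m .
  assume "(\<lambda>i. \<nu> (del_window m i)) \<in> {\<omega>. three_clusters m \<omega>}"
  moreover have "gaps (\<lambda>i. \<nu> (del_window m i)) = R"
    unfolding gaps_def R_def spin_del_window[of \<nu> m] ..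
  ultimately obtain x y z where "x \<in> t" "y \<in> t" "z \<in> t"
    "infinite (R\<^sup>* `` {x})" "infinite (R\<^sup>* `` {y})" "infinite (R\<^sup>* `` {z})"
    "(x, y) \<notin> R\<^sup>*" "(x, z) \<notin> R\<^sup>*" "(y, z) \<notin> R\<^sup>*"
    unfolding mem_Collect_eq three_clusters_def window_def t_def by auto
  then have "trifurcation R' t'" by (rule surgery_trifurcation)
  then show "\<nu> \<in> {\<omega>. trifurcation (gaps \<omega>) (window 0 (2 * m))}"
    by (simp add: gaps_def R'_def window_def t'_def)
qed

lemma unique_pos:
  assumes m: "even m" "0 \<le> m" and "measure coins {\<omega>. all_meet m \<omega>} > 0"
  shows "measure coins {\<omega>. unique_cluster (spin True \<omega>) (spin False \<omega>) 0} > 0"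
proof (rule surgery_pos[OF m sets_all_meet sets_unique assms(3)])
  fix \<nu> assume "surgery (spin True \<nu>) (spin False \<nu>) m"
  then interpret surgery "spin True \<nu>" "spin False \<nu>" m .
  assume "(\<lambda>i. \<nu> (del_window m i)) \<in> {\<omega>. all_meet m \<omega>}"
  then have meet: "all_meet m (\<lambda>i. \<nu> (del_window m i))" by (rule CollectD)
  have eq: "gaps (\<lambda>i. \<nu> (del_window m i)) = R"
    unfolding gaps_def R_def spin_del_window[of \<nu> m] ..
  have t: "t = window 0 m" by (simp add: t_def window_def)
  have "\<exists>y\<in>t. (x, y) \<in> R\<^sup>*" if "even x" "infinite (R\<^sup>* `` {x})" for x
    using meet that unfolding all_meet_def eq t by blast
  then have "unique_cluster (spin True \<nu>) (spin False \<nu>) 0" by (rule surgery_unique)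
  then show "\<nu> \<in> {\<omega>. unique_cluster (spin True \<omega>) (spin False \<omega>) 0}" by simp
qed

lemma prob_trifurcation_translate:
  assumes "even n"
  shows "measure coins {\<omega>. trifurcation (gaps \<omega>) (window n l)} = measure coins {\<omega>. trifurcation (gaps \<omega>) (window 0 l)}"
proof -
  have w: "x \<in> window 0 l \<longleftrightarrow> x + n \<in> window n l" for x
    unfolding window_def mem_Collect_eq using assms by simp
  have "{\<omega>. trifurcation (gaps \<omega>) (window n l)} = translate n -` {\<omega>. trifurcation (gaps \<omega>) (window 0 l)}"
    unfolding vimage_def mem_Collect_eq trifurcation_translate[OF gaps_translate w] ..
  then show ?thesis using prob_translate[OF sets_trifurcation] by simp
qed

section \<open>Trifurcations have probability zero\<close>

lemma prob_coins_UNIV: "measure coins UNIV = 1"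
  using C.prob_space by simp

lemma indep_coins: "C.indep_vars (\<lambda>_. coin) (\<lambda>i \<omega>. \<omega> i) (UNIV :: 'i set)"
proof (subst C.indep_vars_iff_distr_eq_PiM)
  show "(\<lambda>\<omega>. \<omega> i) \<in> measurable coins coin" for i :: 'i
    unfolding measurable_coin by (rule measurable_coins_component)
  have comp: "distr coins coin (\<lambda>\<omega>. \<omega> i) = coin" for i :: 'i
    unfolding coins_def by (rule coins.PiM_component) simp
  have "distr coins (Pi\<^sub>M UNIV (\<lambda>_. coin)) (\<lambda>\<omega>. \<omega>) = (coins :: ('i \<Rightarrow> bool) measure)"
    unfolding coins_def by (rule distr_id)
  then show "distr coins (Pi\<^sub>M UNIV (\<lambda>_. coin)) (\<lambda>\<omega>. \<lambda>i\<in>UNIV. \<omega> i) =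
      Pi\<^sub>M UNIV (\<lambda>i :: 'i. distr coins coin (\<lambda>\<omega>. \<omega> i))"
    unfolding comp restrict_UNIV by (simp add: coins_def)
qed simp

text \<open>Hoeffding's inequality for \<open>j\<close> independent signs: the squared lengths of
  the ranges add up to \<open>4 * j\<close>, so the exponent \<open>2 * h\<^sup>2 / (4 * j)\<close>
  reduces to the one stated.\<close>

lemma walk_deviation:
  assumes "0 < j" "0 \<le> h"
  shows "measure coins {\<omega>. h \<le> \<bar>real_of_int (walk (spin b \<omega>) j)\<bar>} \<le> 2 * exp (- (h\<^sup>2 / (2 * real_of_int j)))"
proof -
  define I where "I = Pair b ` {0<..j}"
  define X where "X = (\<lambda>i \<omega>. if \<omega> (i :: bool \<times> int) then 1 else - 1 :: real)"
  have mean: "C.expectation (X i) = 0" for i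
  proof -
    have "X i = (\<lambda>\<omega>. 2 * indicator (cylinder {i} (\<lambda>_. {True})) \<omega> - 1)"
      by (auto simp: X_def cylinder_def fun_eq_iff)
    moreover have "integrable coins (indicator (cylinder {i} (\<lambda>_. {True})) :: _ \<Rightarrow> real)"
      by (intro integrable_real_indicator sets_cylinder) (auto simp: C.emeasure_eq_measure)
    ultimately show ?thesis
      by (simp add: measure_cylinder prob_coins_UNIV)
  qed
  have "C.indep_vars (\<lambda>_. borel) X I"
  proof -
    define v where "v = (\<lambda>b. if b then 1 else - 1 :: real)"
    have "C.indep_vars (\<lambda>_. coin) (\<lambda>i \<omega>. \<omega> i) I"
      by (rule C.indep_vars_subset[OF indep_coins subset_UNIV])
    moreover have "v \<in> borel_measurable coin" by (simp add: measurable_def)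
    ultimately have "C.indep_vars (\<lambda>_. borel) (\<lambda>i \<omega>. v (\<omega> i)) I"
      by (rule C.indep_vars_compose2)
    moreover have "X = (\<lambda>i \<omega>. v (\<omega> i))" unfolding X_def v_def ..
    ultimately show ?thesis by (rule ssubst[rotated])
  qed
  then interpret H: Hoeffding_ineq coins I X "\<lambda>_. - 1" "\<lambda>_. 1" 0
  proof unfold_locales
    show "finite I" by (simp add: I_def)
    show "AE \<omega> in coins. X i \<omega> \<in> {- 1..1}" for i by (simp add: X_def)
    show "0 \<equiv> \<Sum>i\<in>I. C.expectation (X i)" by (simp add: mean)
  qed
  have card: "card I = nat j" by (simp add: I_def card_image inj_on_def)
  have sum: "(\<Sum>i\<in>I. X i \<omega>) = real_of_int (walk (spin b \<omega>) j)" for \<omega>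
  proof -
    have "(\<Sum>i\<in>I. X i \<omega>) = (\<Sum>k\<in>{0<..j}. real_of_int (spin b \<omega> k))"
      unfolding I_def by (subst sum.reindex) (auto simp: inj_on_def X_def spin_def intro!: sum.cong)
    then show ?thesis using assms(1) by (simp add: walk_def)
  qed
  have "measure coins {\<omega> \<in> space coins. h \<le> \<bar>(\<Sum>i\<in>I. X i \<omega>) - 0\<bar>} \<le>
      2 * exp (- 2 * h\<^sup>2 / (\<Sum>i\<in>I. (1 - - 1 :: real)\<^sup>2))"
    by (rule H.Hoeffding_ineq_abs_ge) (use assms card in auto)
  then show ?thesis using assms(1) by (simp add: sum card field_simps)
qed

lemma sets_deviation: "{\<omega>. h \<le> \<bar>real_of_int (walk (spin b \<omega>) x)\<bar>} \<in> sets coins"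
proof (rule sets_coins_finite_dep)
  show "finite (Pair b ` ({0<..x} \<union> {x<..0}))" by simp
  fix \<omega> \<omega>' :: config
  assume eq: "\<And>j. j \<in> Pair b ` ({0<..x} \<union> {x<..0}) \<Longrightarrow> \<omega> j = \<omega>' j"
    and h: "h \<le> \<bar>real_of_int (walk (spin b \<omega>) x)\<bar>"
  have "spin b \<omega> k = spin b \<omega>' k" if "k \<in> {0<..x} \<union> {x<..0}" for k
    using eq[of "(b, k)"] that by (auto simp: spin_def)
  then have "walk (spin b \<omega>) x = walk (spin b \<omega>') x"
    unfolding walk_def by (intro arg_cong2[where f = "(-)"] sum.cong) auto
  then show "h \<le> \<bar>real_of_int (walk (spin b \<omega>') x)\<bar>" using h by simp
qed

text \<open>The exceptional event for the count of exits. The position 0 is left out because the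
  walk vanishes there.\<close>

definition large :: "int \<Rightarrow> nat \<Rightarrow> config set" where
  "large n h = (\<Union>b\<in>UNIV. \<Union>x\<in>{0<..n}. {\<omega>. real h \<le> \<bar>real_of_int (walk (spin b \<omega>) x)\<bar>})"

lemma sets_large: "large n h \<in> sets coins"
  unfolding large_def by (intro sets.finite_UN sets_deviation) auto

text \<open>Union bound over two walks and \<open>n\<close> positions; the deviation bound is
  weakest at the last position.\<close>

lemma prob_large: "measure coins (large n h) \<le> 4 * real_of_int n * exp (- ((real h)\<^sup>2 / (2 * real_of_int n)))"
  if "0 < n"
proof -
  let ?e = "exp (- ((real h)\<^sup>2 / (2 * real_of_int n)))"
  define D where "D = (\<lambda>(b, x). {\<omega>. real h \<le> \<bar>real_of_int (walk (spin b \<omega>) x)\<bar>})"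
  have D: "D i \<in> sets coins" for i unfolding D_def by (cases i) (simp add: sets_deviation)
  have "large n h = (\<Union>i\<in>UNIV \<times> {0<..n}. D i)" by (auto simp: large_def D_def)
  also have "measure coins \<dots> \<le> (\<Sum>i\<in>UNIV \<times> {0<..n}. measure coins (D i))"
    using D by (intro C.finite_measure_subadditive_finite) auto
  also have "\<dots> \<le> (\<Sum>i\<in>(UNIV :: bool set) \<times> {0<..n}. 2 * ?e)"
  proof (rule sum_mono)
    fix i assume "i \<in> (UNIV :: bool set) \<times> {0<..n}"
    then obtain b x where i: "i = (b, x)" and x: "0 < x" "x \<le> n" by auto
    have "measure coins (D i) \<le> 2 * exp (- ((real h)\<^sup>2 / (2 * real_of_int x)))"
      unfolding D_def i prod.case by (rule walk_deviation) (use x in auto)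
    also have "\<dots> \<le> 2 * ?e"
      using x by (auto intro!: divide_left_mono)
    finally show "measure coins (D i) \<le> 2 * ?e" .
  qed
  also have "\<dots> = 4 * real_of_int n * ?e" using that by (simp add: card_cartesian_product)
  finally show ?thesis .
qed

text \<open>Windows contain both of their end gaps, so the spacing \<open>l + 2\<close> is what
  keeps consecutive ones disjoint. The trifurcating ones are then bounded by the exits of the
  interval, whose walks have height at most \<open>h\<close>.\<close>

lemma trifurcation_count:
  fixes r h :: nat and l :: int
  assumes l: "even l" "0 \<le> l" and n: "n = int r * (l + 2)" and good: "\<omega> \<notin> large n h"
  shows "card {i \<in> {..<r}. trifurcation (gaps \<omega>) (window (int i * (l + 2)) l)} \<le> 4 * (2 * h + 1)"
proof -
  define W where "W i = window (int i * (l + 2)) l" for i :: nat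
  define S where "S = {i \<in> {..<r}. trifurcation (gaps \<omega>) (W i)}"
  define Y where "Y = {u. u \<notin> {0..n} \<and> (\<exists>y\<in>{0..n}. (y, u) \<in> gaps \<omega>)}"
  have walk: "\<bar>walk (spin b \<omega>) x\<bar> \<le> int h" if "0 \<le> x" "x \<le> n" for b x
  proof (cases "x = 0")
    case True
    then show ?thesis by (simp add: walk_def)
  next
    case False
    then have "\<not> real h \<le> \<bar>real_of_int (walk (spin b \<omega>) x)\<bar>" using good that unfolding large_def by auto
    then show ?thesis by linarith
  qed
  have Y: "finite Y \<and> card Y \<le> 4 * nat (2 * int h + 1)"
    using gap_exits[OF signs_spin signs_spin walk walk Y_def[unfolded gaps_def]] by blast
  have disj: "W i \<inter> W j = {}" if "i \<noteq> j" for i j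
  proof -
    have "W i \<inter> W j = {}" if "i < j" for i j
    proof -
      have "int i * (l + 2) + (l + 2) \<le> int j * (l + 2)"
        using mult_right_mono[of "int i + 1" "int j" "l + 2"] that l by (simp add: algebra_simps)
      then show ?thesis by (auto simp: W_def window_def)
    qed
    then show ?thesis using \<open>i \<noteq> j\<close> by (metis Int_commute linorder_neqE_nat)
  qed
  have ne: "W i \<noteq> {}" for i
  proof -
    have "int i * (l + 2) \<in> W i" using l by (simp add: W_def window_def)
    then show ?thesis by blast
  qed
  have sub: "W i \<subseteq> {0..n}" if "i < r" for i
  proof -
    have "int i * (l + 2) + (l + 2) \<le> int r * (l + 2)"
      using mult_right_mono[of "int i + 1" "int r" "l + 2"] that l by (simp add: algebra_simps)
    moreover have "0 \<le> int i * (l + 2)" using l by simp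
    ultimately have "x \<in> {0..n}" if "int i * (l + 2) \<le> x" "x \<le> int i * (l + 2) + l" for x
      unfolding n atLeastAtMost_iff using that by linarith
    then show ?thesis by (auto simp: W_def window_def)
  qed
  have inj: "inj_on W S" using disj ne by (intro inj_onI) (metis Int_absorb)
  have "card (W ` S) \<le> card Y"
  proof (rule trifurcations_le_exits[OF sym_gaps _ Y_def])
    show "\<And>t. t \<in> W ` S \<Longrightarrow> trifurcation (gaps \<omega>) t \<and> t \<subseteq> {0..n} \<and> t \<noteq> {}"
      using sub ne by (auto simp: S_def)
    fix s t assume st: "s \<in> W ` S" "t \<in> W ` S" "s \<noteq> t"
    obtain i j where ij: "s = W i" "t = W j" using st(1,2) by (elim imageE)
    then have "i \<noteq> j" using st(3) by auto
    then show "s \<inter> t = {}" unfolding ij by (rule disj)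
  qed (use Y in \<open>simp_all add: S_def\<close>)
  then have "card S \<le> 4 * nat (2 * int h + 1)" using Y card_image[OF inj] by simp
  moreover have "nat (2 * int h + 1) = 2 * h + 1" by simp
  ultimately show ?thesis by (simp only: S_def W_def)
qed

text \<open>By translation invariance the left side is the expected number of trifurcating windows
  among \<open>r\<close>. This number is bounded by the count of exits off \<open>large n h\<close>
  and trivially by \<open>r\<close> on it.\<close>

lemma trifurcation_density:
  fixes r h :: nat and l :: int
  assumes l: "even l" "0 \<le> l" and n: "n = int r * (l + 2)"
  shows "real r * measure coins {\<omega>. trifurcation (gaps \<omega>) (window 0 l)} \<le>
    real (4 * (2 * h + 1)) + real r * measure coins (large n h)"
proof -
  define T where "T i = {\<omega>. trifurcation (gaps \<omega>) (window (int i * (l + 2)) l)}" for i :: nat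
  have T: "T i \<in> sets coins" for i unfolding T_def by (rule sets_trifurcation)
  have prob: "measure coins (T i) = measure coins {\<omega>. trifurcation (gaps \<omega>) (window 0 l)}" for i
    unfolding T_def by (rule prob_trifurcation_translate) (use l in simp)
  have count: "(\<Sum>i<r. indicator (T i) \<omega>) = real (card {i \<in> {..<r}. \<omega> \<in> T i})" for \<omega>
    by (simp add: indicator_def sum.If_cases Int_def)
  have int: "integrable coins (indicator A :: config \<Rightarrow> real)" if "A \<in> sets coins" for A
    using that by (intro integrable_real_indicator) (auto simp: C.emeasure_eq_measure)
  have "real r * measure coins {\<omega>. trifurcation (gaps \<omega>) (window 0 l)} =
      C.expectation (\<lambda>\<omega>. \<Sum>i<r. indicator (T i) \<omega>)"
    using T int by (subst Bochner_Integration.integral_sum) (auto simp: prob)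
  also have "\<dots> \<le> C.expectation (\<lambda>\<omega>. real (4 * (2 * h + 1)) + real r * indicator (large n h) \<omega>)"
  proof (rule integral_mono)
    show "integrable coins (\<lambda>\<omega>. \<Sum>i<r. indicator (T i) \<omega> :: real)" using T int by auto
    show "integrable coins (\<lambda>\<omega>. real (4 * (2 * h + 1)) + real r * indicator (large n h) \<omega>)"
      using int[OF sets_large[of n h]] by (intro Bochner_Integration.integrable_add) auto
    fix \<omega> :: config
    show "(\<Sum>i<r. indicator (T i) \<omega>) \<le> real (4 * (2 * h + 1)) + real r * indicator (large n h) \<omega>"
    proof (cases "\<omega> \<in> large n h")
      case True
      have "card {i \<in> {..<r}. \<omega> \<in> T i} \<le> card {..<r}" by (rule card_mono) auto
      then show ?thesis unfolding count using True by simp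
    next
      case False
      then show ?thesis unfolding count
        using trifurcation_count[OF l n False] by (simp add: T_def)
    qed
  qed
  also have "\<dots> = real (4 * (2 * h + 1)) + real r * measure coins (large n h)"
    using int[OF sets_large[of n h]] sets_large[of n h]
    by (subst Bochner_Integration.integral_add) (auto simp: prob_coins_UNIV)
  finally show ?thesis .
qed

text \<open>Take \<open>k ^ 4\<close> windows and the height \<open>k ^ 3\<close>. This height
  exceeds the diffusive scale \<open>k ^ 2\<close> by a power, so the exponential factor beats the
  polynomial one, and it is of smaller order than the number of windows, so the exits per window
  tend to zero.\<close>

lemma no_trifurcation:
  assumes l: "even l" "0 \<le> l"
  shows "measure coins {\<omega>. trifurcation (gaps \<omega>) (window 0 l)} = 0"
proof -
  define \<tau> where "\<tau> = measure coins {\<omega>. trifurcation (gaps \<omega>) (window 0 l)}"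
  define d where "d = real_of_int l + 2"
  have d: "d > 0" using l by (simp add: d_def)
  define g where "g k = (8 * real k ^ 3 + 4) / real k ^ 4 + 4 * (real k ^ 4 * d) * exp (- (real k ^ 2 / (2 * d)))"
    for k :: nat
  have "\<tau> \<le> g k" if k: "k \<ge> 1" for k
  proof -
    define n where "n = int (k ^ 4) * (l + 2)"
    have n: "real_of_int n = real k ^ 4 * d" by (simp add: n_def d_def)
    have npos: "0 < n" using l k by (simp add: n_def)
    have "real (k ^ 4) * \<tau> \<le> real (4 * (2 * k ^ 3 + 1)) + real (k ^ 4) * measure coins (large n (k ^ 3))"
      unfolding \<tau>_def by (rule trifurcation_density[OF l n_def])
    also have "\<dots> \<le> real (4 * (2 * k ^ 3 + 1)) +
        real (k ^ 4) * (4 * real_of_int n * exp (- ((real (k ^ 3))\<^sup>2 / (2 * real_of_int n))))"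
      by (intro add_left_mono mult_left_mono prob_large npos) simp
    also have "(real (k ^ 3))\<^sup>2 / (2 * real_of_int n) = real k ^ 2 / (2 * d)"
    proof -
      have 1: "(real (k ^ 3))\<^sup>2 = real k ^ 4 * real k ^ 2" by (simp flip: power_mult power_add)
      have 2: "2 * (real k ^ 4 * d) = real k ^ 4 * (2 * d)" by simp
      have "real k ^ 4 \<noteq> 0" using k by simp
      then show ?thesis unfolding n 1 2 by (rule nonzero_mult_divide_mult_cancel_left)
    qed
    finally have "real k ^ 4 * \<tau> \<le> (8 * real k ^ 3 + 4) +
        real k ^ 4 * (4 * (real k ^ 4 * d) * exp (- (real k ^ 2 / (2 * d))))"
      by (simp add: n)
    also have "\<dots> = real k ^ 4 * g k" unfolding g_def distrib_left using k by simp
    finally show ?thesis using k by simp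
  qed
  then have "\<forall>\<^sub>F k in sequentially. \<tau> \<le> g k"
    by (intro eventually_sequentiallyI[of 1])
  moreover have "g \<longlonglongrightarrow> 0" unfolding g_def using d by real_asymp
  ultimately have "\<tau> \<le> 0" by (intro tendsto_lowerbound[of g 0 sequentially]) auto
  then show ?thesis using measure_nonneg[of coins] by (simp add: \<tau>_def order.antisym)
qed

section \<open>Uniqueness of the infinite cluster\<close>

lemma AE_null: "A \<in> sets coins \<Longrightarrow> measure coins A = 0 \<Longrightarrow> AE \<omega> in coins. \<omega> \<notin> A"
  by (intro AE_I[where N = A]) (auto simp: C.emeasure_eq_measure)

text \<open>Events are formulated at the origin only; discarding one null set allows the window to
  be placed anywhere, depending on the configuration.\<close>

lemma AE_translate:
  assumes "A \<in> sets coins" "measure coins A = 0"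
  shows "AE \<omega> in coins. \<forall>n. translate n \<omega> \<notin> A"
  unfolding AE_all_countable
proof
  fix n
  have "measure coins (translate n -` A) = 0" using assms by (simp add: prob_translate)
  then show "AE \<omega> in coins. translate n \<omega> \<notin> A"
    using AE_null[OF sets_translate[OF assms(1), of n]] by simp
qed

lemma three_clusters_null:
  assumes "even m" "0 \<le> m"
  shows "measure coins {\<omega>. three_clusters m \<omega>} = 0"
proof (rule ccontr)
  assume "measure coins {\<omega>. three_clusters m \<omega>} \<noteq> 0"
  then have "measure coins {\<omega>. three_clusters m \<omega>} > 0"
    using measure_nonneg[of coins] by (simp add: order.strict_iff_order)
  from trifurcation_pos[OF assms this] show False using no_trifurcation[of "2 * m"] assms by simp
qed

text \<open>A finite number of at least two infinite clusters of the same parity contradicts ergodicity,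
  as the surgery would merge them with positive probability.\<close>

lemma unique_even_as: "measure coins {\<omega>. unique_cluster (spin True \<omega>) (spin False \<omega>) 0} = 1"
proof (rule ccontr)
  let ?U = "{\<omega>. unique_cluster (spin True \<omega>) (spin False \<omega>) 0}"
  assume ne: "measure coins ?U \<noteq> 1"
  have "translate 2 -` ?U = ?U"
    unfolding vimage_def mem_Collect_eq unique_translate
    using unique_parity[of "0 + 2" 0] by simp
  then have U0: "measure coins ?U = 0" using ergodic[OF sets_unique] ne by blast
  \<comment> \<open>If all infinite even clusters met a fixed window with positive probability,
    surgery would give uniqueness with positive probability.\<close>
  have all0: "measure coins {\<omega>. all_meet (2 * int k) \<omega>} = 0" for k
  proof (rule ccontr)
    assume "measure coins {\<omega>. all_meet (2 * int k) \<omega>} \<noteq> 0"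
    then have "measure coins {\<omega>. all_meet (2 * int k) \<omega>} > 0"
      using measure_nonneg[of coins] by (simp add: order.strict_iff_order)
    then show False using unique_pos[of "2 * int k"] U0 by simp
  qed
  have "AE \<omega> in coins. \<forall>k n. translate n \<omega> \<notin> {\<omega>. all_meet (2 * int k) \<omega>}"
    using AE_translate[OF sets_all_meet all0] by (simp only: AE_all_countable) blast
  moreover have "AE \<omega> in coins. \<forall>k n. translate n \<omega> \<notin> {\<omega>. three_clusters (2 * int k) \<omega>}"
    using AE_translate[OF sets_three_clusters three_clusters_null] by (simp only: AE_all_countable) simp
  moreover have "AE \<omega> in coins. \<omega> \<notin> ?U" by (rule AE_null[OF sets_unique U0])
  ultimately have "AE \<omega> in (coins :: config measure). False"
  proof eventually_elim
    case (elim \<omega>)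
    let ?G = "gaps \<omega>"
    obtain x y where xy: "even x" "even y" "infinite (?G\<^sup>* `` {x})" "infinite (?G\<^sup>* `` {y})" "(x, y) \<notin> ?G\<^sup>*"
      using elim(3) unfolding mem_Collect_eq unique_cluster_def gap_cluster_def gaps_def[symmetric]
      by (metis diff_zero)
    \<comment> \<open>The window is moved to start at the least of the three gaps. Differences of
      the gaps are at most twice the sum of their absolute values, whence its length.\<close>
    have window: "\<exists>k. \<forall>v\<in>{x, y, z}. v - a \<in> window 0 (2 * int k)"
      if "even z" "a = Min {x, y, z}" for z a
    proof
      have a: "a \<in> {x, y, z}" unfolding that(2) by (rule Min_in) auto
      have le: "a \<le> v" if "v \<in> {x, y, z}" for v unfolding \<open>a = Min {x, y, z}\<close> using that by (intro Min_le) auto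
      have "even a" using a xy that(1) by auto
      then show "\<forall>v\<in>{x, y, z}. v - a \<in> window 0 (2 * int (nat (\<bar>x\<bar> + \<bar>y\<bar> + \<bar>z\<bar>)))"
        using le a xy(1,2) that(1) unfolding window_def by auto
    qed
    have inf: "infinite ((gaps (translate a \<omega>))\<^sup>* `` {v - a}) \<longleftrightarrow> infinite (?G\<^sup>* `` {v})" for a v
      using infinite_class_translate[OF gaps_translate, of a \<omega> "v - a"] by simp
    have path: "(v - a, w - a) \<in> (gaps (translate a \<omega>))\<^sup>* \<longleftrightarrow> (v, w) \<in> ?G\<^sup>*" for a v w
      using rtrancl_translate[OF gaps_translate, of "v - a" "w - a" a \<omega>] by simp
    \<comment> \<open>A third infinite even cluster would meet a translated window together with
      those of \<open>x\<close> and \<open>y\<close>, which the discarded null sets exclude.\<close>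
    have third: "(x, z) \<in> ?G\<^sup>* \<or> (y, z) \<in> ?G\<^sup>*" if z: "even z" "infinite (?G\<^sup>* `` {z})" for z
    proof (rule ccontr)
      assume no: "\<not> ((x, z) \<in> ?G\<^sup>* \<or> (y, z) \<in> ?G\<^sup>*)"
      define a where "a = Min {x, y, z}"
      obtain k where k: "\<forall>v\<in>{x, y, z}. v - a \<in> window 0 (2 * int k)" using window[OF z(1) a_def] by blast
      have "three_clusters (2 * int k) (translate a \<omega>)"
        unfolding three_clusters_def
        by (intro exI[of _ "x - a"] exI[of _ "y - a"] exI[of _ "z - a"])
          (use k no xy z in \<open>simp add: inf path\<close>)
      then show False using elim(2) by blast
    qed
    \<comment> \<open>Repeating \<open>x\<close> reuses \<open>window\<close> for the two gaps
      \<open>x\<close> and \<open>y\<close>. Every infinite even cluster contains one of them, so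
      all of them meet this window, contrary to \<open>all0\<close>.\<close>
    define a where "a = Min {x, y, x}"
    obtain k where k: "\<forall>v\<in>{x, y, x}. v - a \<in> window 0 (2 * int k)" using window[OF xy(1) a_def] by blast
    have "even a" using k xy(1) by (auto simp: window_def)
    have sym: "(v, u) \<in> ?G\<^sup>*" if "(u, v) \<in> ?G\<^sup>*" for u v
      using that sym_rtrancl[OF sym_gaps] by (meson symD)
    have "all_meet (2 * int k) (translate a \<omega>)"
      unfolding all_meet_def
    proof (intro allI impI)
      fix u assume u: "even u" "infinite ((gaps (translate a \<omega>))\<^sup>* `` {u})"
      have "even (u + a)" using u(1) \<open>even a\<close> by simp
      moreover have "infinite (?G\<^sup>* `` {u + a})" using u(2) inf[of a "u + a"] by simp
      ultimately have "(x, u + a) \<in> ?G\<^sup>* \<or> (y, u + a) \<in> ?G\<^sup>*" by (rule third)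
      then obtain v where v: "v \<in> {x, y, x}" "(u + a, v) \<in> ?G\<^sup>*" using sym by blast
      have "v - a \<in> window 0 (2 * int k)" using k v(1) by blast
      moreover have "(u, v - a) \<in> (gaps (translate a \<omega>))\<^sup>*" using path[of "u + a" a v] v(2) by simp
      ultimately show "\<exists>v. v \<in> window 0 (2 * int k) \<and> (u, v) \<in> (gaps (translate a \<omega>))\<^sup>*" by blast
    qed
    then show False using elim(1) by blast
  qed
  then show False by simp
qed

text \<open>The odd case follows from the even one, as the unit translation preserves the measure
  and exchanges the parities.\<close>

lemma AE_unique: "AE \<omega> in coins. unique_cluster (spin True \<omega>) (spin False \<omega>) 0 \<and>
    unique_cluster (spin True \<omega>) (spin False \<omega>) 1"
proof -
  let ?U = "\<lambda>r. {\<omega>. unique_cluster (spin True \<omega>) (spin False \<omega>) r}"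
  have "translate 1 -` ?U 0 = ?U 1"
    unfolding vimage_def mem_Collect_eq unique_translate by simp
  then have 1: "measure coins (?U 1) = 1"
    using prob_translate[OF sets_unique[of 0], of 1] unique_even_as by simp
  have "AE \<omega> in coins. \<omega> \<in> ?U r" if "measure coins (?U r) = 1" for r
    using C.prob_eq_1[OF sets_unique] that by blast
  from this[OF unique_even_as] this[OF 1] show ?thesis by eventually_elim simp
qed

lemma AE_n_paths:
  "(AE \<omega> in coins. n_paths (spin True \<omega>) (spin False \<omega>) = 0) \<or>
   (AE \<omega> in coins. n_paths (spin True \<omega>) (spin False \<omega>) = 1)"
proof -
  define Q where "Q \<omega> \<longleftrightarrow> (\<exists>p. infinite ((match_adj (spin True \<omega>) (spin False \<omega>))\<^sup>* `` {p}))" for \<omega>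
  have "Measurable.pred coins (\<lambda>\<omega>. Q \<omega>)"
    unfolding Q_def by (intro pred_rules measurable_infinite_class[OF measurable_match_adj])
  then have Q: "{\<omega>. Q \<omega>} \<in> sets coins" by (simp add: pred_def)
  have shift: "Q (translate 2 \<omega>) \<longleftrightarrow> Q \<omega>" for \<omega>
  proof -
    define P where "P p \<longleftrightarrow> infinite ((match_adj (spin True \<omega>) (spin False \<omega>))\<^sup>* `` {p})" for p
    have "Q (translate 2 \<omega>) \<longleftrightarrow> (\<exists>p. P (p + 2))"
      unfolding Q_def P_def infinite_class_translate[OF match_adj_translate] ..
    also have "\<dots> \<longleftrightarrow> (\<exists>p. P p)"
    proof
      assume "\<exists>p. P p"
      then obtain p where "P ((p - 2) + 2)" by auto
      then show "\<exists>p. P (p + 2)" by blast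
    qed blast
    finally show ?thesis by (simp add: Q_def P_def)
  qed
  have "translate 2 -` {\<omega>. Q \<omega>} = {\<omega>. Q \<omega>}" by (simp add: vimage_def shift)
  then consider "measure coins {\<omega>. Q \<omega>} = 0" | "measure coins {\<omega>. Q \<omega>} = 1"
    using ergodic[OF Q] by blast
  then show ?thesis
  proof cases
    case 1
    have "AE \<omega> in coins. n_paths (spin True \<omega>) (spin False \<omega>) = 0"
      using AE_null[OF Q 1] by eventually_elim (rule n_paths_eq_0, simp add: Q_def)
    then show ?thesis ..
  next
    case 2
    have "AE \<omega> in coins. \<omega> \<in> {\<omega>. Q \<omega>}" using C.prob_eq_1[OF Q] 2 by blast
    then have "AE \<omega> in coins. n_paths (spin True \<omega>) (spin False \<omega>) = 1"
      using AE_unique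
    proof eventually_elim
      case (elim \<omega>)
      then obtain p where "infinite ((match_adj (spin True \<omega>) (spin False \<omega>))\<^sup>* `` {p})"
        unfolding Q_def by blast
      with elim(2) show ?case using n_paths_eq_1[OF signs_spin signs_spin] by blast
    qed
    then show ?thesis ..
  qed
qed

section \<open>Transfer from coins to the given random signs\<close>

lemma prob_sign_cylinder:
  fixes X :: "int \<Rightarrow> 'a \<Rightarrow> int" and F :: "int \<Rightarrow> bool set"
  assumes "prob_space M" and indep: "prob_space.indep_vars M (\<lambda>_. count_space {-1, 1}) X UNIV"
    and unif: "\<And>x. distr M (count_space {-1, 1}) (X x) = uniform_count_measure {-1, 1}"
    and J: "finite J"
  shows "measure M {w \<in> space M. \<forall>x\<in>J. (X x w = 1) \<in> F x} = (\<Prod>x\<in>J. card (F x) / 2)"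
proof -
  interpret prob_space M by fact
  let ?S = "count_space {-1, 1 :: int}" and ?V = "uniform_count_measure {-1, 1 :: int}"
  have rv: "X x \<in> measurable M ?S" for x using indep by (simp add: indep_vars_def)
  have V: "prob_space ?V" by (rule prob_space_uniform_count_measure) auto
  define G where "G x = {v \<in> {-1, 1 :: int}. (v = 1) \<in> F x}" for x
  have G: "emeasure ?V (G x) = ennreal (card (F x) / 2)" for x
  proof -
    \<comment> \<open>Signs correspond to booleans under \<open>v = 1\<close>, so the set of
      admissible signs has as many elements as \<open>F x\<close>.\<close>
    have "F x = (\<lambda>v. v = 1) ` G x"
    proof (intro equalityI subsetI)
      fix b assume "b \<in> F x"
      then show "b \<in> (\<lambda>v. v = 1) ` G x"
        by (intro image_eqI[of _ _ "if b then 1 else -1"]) (auto simp: G_def)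
    qed (auto simp: G_def)
    moreover have "inj_on (\<lambda>v. v = 1) (G x)" by (auto simp: G_def inj_on_def)
    ultimately have "card (F x) = card (G x)" using card_image by metis
    moreover have "emeasure ?V (G x) = card (G x) / card {-1, 1 :: int}"
      by (rule emeasure_uniform_count_measure) (auto simp: G_def)
    ultimately show ?thesis by simp
  qed
  have "distr M (Pi\<^sub>M UNIV (\<lambda>_. ?S)) (\<lambda>w. \<lambda>x\<in>UNIV. X x w) = Pi\<^sub>M UNIV (\<lambda>x. distr M ?S (X x))"
    using indep_vars_iff_distr_eq_PiM[of UNIV X "\<lambda>_. ?S"] rv indep by simp
  then have D: "distr M (Pi\<^sub>M UNIV (\<lambda>_. ?S)) (\<lambda>w x. X x w) = Pi\<^sub>M UNIV (\<lambda>_. ?V)"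
    by (simp only: unif restrict_UNIV)
  have val: "X x w \<in> {-1, 1}" if "w \<in> space M" for x w
    using measurable_space[OF rv that] unfolding space_count_space .
  let ?E = "prod_emb UNIV (\<lambda>_. ?S) J (Pi\<^sub>E J G)"
  have E: "?E \<in> sets (Pi\<^sub>M UNIV (\<lambda>_. ?S))"
    by (rule sets_PiM_I[OF J subset_UNIV]) (simp add: G_def subset_iff)
  have meas: "(\<lambda>w x. X x w) \<in> measurable M (Pi\<^sub>M UNIV (\<lambda>_. ?S))"
  proof (rule measurable_PiM_single')
    show "(\<lambda>w x. X x w) \<in> space M \<rightarrow> (\<Pi>\<^sub>E x\<in>UNIV. space ?S)"
      unfolding space_count_space using val by (intro funcsetI PiE_I) blast+
  qed (rule rv)
  have "(\<lambda>x. X x w) \<in> ?E \<longleftrightarrow> (\<forall>x\<in>J. (X x w = 1) \<in> F x)" if "w \<in> space M" for w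
    unfolding prod_emb_def Int_iff vimage_eq restrict_PiE_iff
    unfolding PiE_iff space_count_space extensional_UNIV G_def mem_Collect_eq using val[OF that] by blast
  then have "{w \<in> space M. \<forall>x\<in>J. (X x w = 1) \<in> F x} = (\<lambda>w x. X x w) -` ?E \<inter> space M"
    by blast
  then have "emeasure M {w \<in> space M. \<forall>x\<in>J. (X x w = 1) \<in> F x} =
      emeasure (distr M (Pi\<^sub>M UNIV (\<lambda>_. ?S)) (\<lambda>w x. X x w)) ?E"
    by (simp add: emeasure_distr[OF meas E])
  also have "\<dots> = emeasure (Pi\<^sub>M UNIV (\<lambda>_. ?V)) (prod_emb UNIV (\<lambda>_. ?V) J (Pi\<^sub>E J G))"
    unfolding D by (simp add: prod_emb_def space_uniform_count_measure)
  also have "\<dots> = (\<Prod>x\<in>J. emeasure ?V (G x))"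
    by (rule emeasure_PiM_emb) (use J V in \<open>auto simp: G_def sets_uniform_count_measure\<close>)
  also have "\<dots> = ennreal (\<Prod>x\<in>J. card (F x) / 2)"
    unfolding G by (rule prod_ennreal) simp
  finally show ?thesis by (simp add: emeasure_eq_measure prod_nonneg)
qed

theorem theorem1:
  fixes M :: "'a measure" and \<omega>p \<omega>m :: "int \<Rightarrow> 'a \<Rightarrow> int"
  assumes "prob_space M"
    and "prob_space.indep_vars M (\<lambda>_. count_space {-1, 1}) \<omega>p UNIV"
    and "prob_space.indep_vars M (\<lambda>_. count_space {-1, 1}) \<omega>m UNIV"
    and "\<And>x. distr M (count_space {-1, 1}) (\<omega>p x) = uniform_count_measure {-1, 1}"
    and "\<And>x. distr M (count_space {-1, 1}) (\<omega>m x) = uniform_count_measure {-1, 1}"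
    and "prob_space.indep_var M
           (Pi\<^sub>M UNIV (\<lambda>_. count_space {-1, 1})) (\<lambda>w x. \<omega>p x w)
           (Pi\<^sub>M UNIV (\<lambda>_. count_space {-1, 1})) (\<lambda>w x. \<omega>m x w)"
  shows "(AE w in M. n_paths (\<lambda>x. \<omega>p x w) (\<lambda>x. \<omega>m x w) = 0) \<or>
         (AE w in M. n_paths (\<lambda>x. \<omega>p x w) (\<lambda>x. \<omega>m x w) = 1)"
proof -
  interpret prob_space M by fact
  let ?S = "count_space {-1, 1 :: int}"
  define X where "X w = (\<lambda>i. (if fst i then \<omega>p (snd i) w else \<omega>m (snd i) w) = 1)" for w
  have rv: "\<omega>p x \<in> measurable M ?S" "\<omega>m x \<in> measurable M ?S" for x
    using assms(2,3) by (simp_all add: indep_vars_def)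
  have val: "\<omega>p x w \<in> {-1, 1}" "\<omega>m x w \<in> {-1, 1}" if "w \<in> space M" for x w
    using measurable_space[OF rv(1) that] measurable_space[OF rv(2) that] unfolding space_count_space by blast+
  have one: "(\<lambda>v. v = 1) \<in> measurable ?S (count_space UNIV)" by simp
  have X: "X \<in> measurable M coins"
  proof (rule measurable_coinsI)
    fix i :: "bool \<times> int"
    have "(\<lambda>w. \<omega>p (snd i) w = 1) \<in> measurable M (count_space UNIV)"
      "(\<lambda>w. \<omega>m (snd i) w = 1) \<in> measurable M (count_space UNIV)"
      by (rule measurable_compose[OF rv(1) one], rule measurable_compose[OF rv(2) one])
    then show "(\<lambda>w. X w i) \<in> measurable M (count_space UNIV)"
      unfolding X_def by (cases "fst i") (simp_all only: if_True if_False)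
  qed
  \<comment> \<open>The law is checked on cylinders. An index set splits by its flag into an upper
    and a lower part; independence of the two sequences factors the probability, and independence
    within each sequence evaluates the two factors.\<close>
  have D: "distr M coins X = coins"
  proof (rule coins_eqI)
    fix J :: "(bool \<times> int) set" and F :: "bool \<times> int \<Rightarrow> bool set"
    assume J: "finite J"
    define Jb where "Jb b = {x. (b, x) \<in> J}" for b
    have Jb: "finite (Jb b)" for b
      unfolding Jb_def by (rule finite_subset[of _ "snd ` J"]) (use J in force)+
    have J_eq: "J = Pair True ` Jb True \<union> Pair False ` Jb False"
    proof (rule set_eqI)
      fix i :: "bool \<times> int"
      obtain b x where i: "i = (b, x)" by (rule prod.exhaust)
      show "i \<in> J \<longleftrightarrow> i \<in> Pair True ` Jb True \<union> Pair False ` Jb False"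
        unfolding i Jb_def by (cases b) auto
    qed
    have cyl: "\<omega> \<in> cylinder J F \<longleftrightarrow>
        (\<forall>x\<in>Jb True. \<omega> (True, x) \<in> F (True, x)) \<and> (\<forall>x\<in>Jb False. \<omega> (False, x) \<in> F (False, x))" for \<omega>
      unfolding cylinder_def by (subst J_eq) (simp add: ball_Un)
    define A where "A b = {f \<in> space (Pi\<^sub>M UNIV (\<lambda>_. ?S)). \<forall>x\<in>Jb b. (f x = 1) \<in> F (b, x)}" for b
    have inA: "f \<in> A b \<longleftrightarrow> (\<forall>x\<in>Jb b. (f x = 1) \<in> F (b, x))" if "\<And>x. f x \<in> {-1, 1}" for f b
      unfolding A_def space_PiM mem_Collect_eq PiE_iff space_count_space extensional_UNIV using that by blast
    have memp: "(\<lambda>x. \<omega>p x w) \<in> A b \<longleftrightarrow> (\<forall>x\<in>Jb b. (\<omega>p x w = 1) \<in> F (b, x))"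
      and memm: "(\<lambda>x. \<omega>m x w) \<in> A b \<longleftrightarrow> (\<forall>x\<in>Jb b. (\<omega>m x w = 1) \<in> F (b, x))"
      if "w \<in> space M" for w b
      by (rule inA, rule val[OF that])+
    have A: "A b \<in> sets (Pi\<^sub>M UNIV (\<lambda>_. ?S))" for b
    proof -
      have "A b = prod_emb UNIV (\<lambda>_. ?S) (Jb b) (\<Pi>\<^sub>E x\<in>Jb b. {v \<in> {-1, 1}. (v = 1) \<in> F (b, x)})"
        by (auto simp: A_def prod_emb_def space_PiM PiE_iff)
      also have "\<dots> \<in> sets (Pi\<^sub>M UNIV (\<lambda>_. ?S))"
        by (rule sets_PiM_I) (use Jb in auto)
      finally show ?thesis .
    qed
    have "emeasure (distr M coins X) (cylinder J F) = emeasure M (X -` cylinder J F \<inter> space M)"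
      by (rule emeasure_distr[OF X sets_cylinder[OF J]])
    also have "X -` cylinder J F \<inter> space M =
        (\<lambda>w. ((\<lambda>x. \<omega>p x w), (\<lambda>x. \<omega>m x w))) -` (A True \<times> A False) \<inter> space M"
      using memp memm unfolding X_def by (simp add: set_eq_iff cyl conj_commute cong: conj_cong)
    also have "emeasure M \<dots> = ennreal (prob ((\<lambda>w x. \<omega>p x w) -` A True \<inter> space M) *
        prob ((\<lambda>w x. \<omega>m x w) -` A False \<inter> space M))"
      unfolding emeasure_eq_measure by (subst indep_varD[OF assms(6) A A]) simp
    also have "(\<lambda>w x. \<omega>p x w) -` A True \<inter> space M = {w \<in> space M. \<forall>x\<in>Jb True. (\<omega>p x w = 1) \<in> F (True, x)}"
      using memp by blast
    also have "prob \<dots> = (\<Prod>x\<in>Jb True. card (F (True, x)) / 2)"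
      by (rule prob_sign_cylinder[OF assms(1,2,4) Jb])
    also have "(\<lambda>w x. \<omega>m x w) -` A False \<inter> space M = {w \<in> space M. \<forall>x\<in>Jb False. (\<omega>m x w = 1) \<in> F (False, x)}"
      using memm by blast
    also have "prob \<dots> = (\<Prod>x\<in>Jb False. card (F (False, x)) / 2)"
      by (rule prob_sign_cylinder[OF assms(1,3,5) Jb])
    also have "(\<Prod>x\<in>Jb True. card (F (True, x)) / 2) * (\<Prod>x\<in>Jb False. card (F (False, x)) / 2) =
        (\<Prod>j\<in>J. real (card (F j)) / 2)"
      by (subst J_eq, subst prod.union_disjoint) (use Jb in \<open>auto simp: prod.reindex inj_on_def\<close>)
    finally show "emeasure (distr M coins X) (cylinder J F) = ennreal (\<Prod>j\<in>J. real (card (F j)) / 2)" .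
  qed simp
  have transfer: "(AE \<omega> in coins. P \<omega>) \<Longrightarrow> AE w in M. P (X w)" for P
    using AE_distrD[OF X, of P] unfolding D .
  \<comment> \<open>On the space of \<open>M\<close> all values are \<open>1\<close> or
    \<open>-1\<close>, so \<open>spin\<close> recovers the signs from their boolean code.\<close>
  have spin: "spin True (X w) = (\<lambda>x. \<omega>p x w) \<and> spin False (X w) = (\<lambda>x. \<omega>m x w)" if "w \<in> space M" for w
  proof (intro conjI ext)
    show "spin True (X w) x = \<omega>p x w" "spin False (X w) x = \<omega>m x w" for x
      using val[OF that, of x] by (auto simp: spin_def X_def)
  qed
  have "AE w in M. n_paths (\<lambda>x. \<omega>p x w) (\<lambda>x. \<omega>m x w) = c"
    if "AE \<omega> in coins. n_paths (spin True \<omega>) (spin False \<omega>) = c" for c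
    using transfer[OF that] AE_space by eventually_elim (use spin in auto)
  then show ?thesis using AE_n_paths by blast
qed

end
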